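(* Let $P\subset\mathbb{R}^d$ be a full-dimensional polytope such that some inscribed polytope has the same normal fan $\mathcal{F}$ as $P$. Then the following are equivalent: (i) $P$ is even, i.e. every $2$-face of $P$ has an even number of vertices; (ii) $\dim\mathrm{InCone}(P)=d$; (iii) $\mathrm{InSpc}(\mathcal{F},R_0)=\mathbb{R}^d$ for any region $R_0$ of $\mathcal{F}$.
   Context: $\mathrm{InCone}(P)$ is the set of polytopes with all vertices on a common sphere and normal fan $\mathcal{F}$, modulo translation (a polyhedral cone). The dual graph of $\mathcal{F}$ has the regions (full-dimensional cones) as nodes, with $R,R'$ adjacent if $R\cap R'$ is $(d-1)$-dimensional; $s_{RR'}$ is the reflection in the linear span of $R\cap R'$, and for a walk $\mathcal{W}=R_0R_1\cdots R_k$, $t_{\mathcal{W}}=s_{R_kR_{k-1}}\cdots s_{R_1R_0}$. The based inscribed space $\mathrm{InSpc}(\mathcal{F},R_0)$ is the set of $v\in\mathbb{R}^d$ (orthogonal to the lineality space, here $\{0\}$) with $t_{\mathcal{W}}(v)=v$ for all closed walks $\mathcal{W}$ starting at $R_0$. *)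

theory Defs
  imports "HOL-Analysis.Analysis" "HOL-Library.Function_Algebras"
begin

definition vertices :: "'a::real_vector set \<Rightarrow> 'a set" where
  "vertices Q = {v. v extreme_point_of Q}"

definition inscribed :: "'a::euclidean_space set \<Rightarrow> bool" where
  "inscribed Q \<longleftrightarrow> polytope Q \<and> (\<exists>c r. \<forall>v \<in> vertices Q. dist c v = r)"

definition even_polytope :: "'a::euclidean_space set \<Rightarrow> bool" where
  "even_polytope P \<longleftrightarrow> (\<forall>F. F face_of P \<and> aff_dim F = 2 \<longrightarrow> even (card (vertices F)))"

definition normal_cone :: "'a::euclidean_space set \<Rightarrow> 'a set \<Rightarrow> 'a set" where
  "normal_cone P F = {c. \<forall>x \<in> F. \<forall>y \<in> P. inner c y \<le> inner c x}"

definition normal_fan :: "'a::euclidean_space set \<Rightarrow> 'a set set" where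
  "normal_fan P = {normal_cone P F | F. F face_of P \<and> F \<noteq> {}}"

definition regions :: "'a::euclidean_space set set \<Rightarrow> 'a set set" where
  "regions \<F> = {R \<in> \<F>. aff_dim R = int DIM('a)}"

definition adjacent :: "'a::euclidean_space set set \<Rightarrow> 'a set \<Rightarrow> 'a set \<Rightarrow> bool" where
  "adjacent \<F> R R' \<longleftrightarrow> R \<in> regions \<F> \<and> R' \<in> regions \<F> \<and> aff_dim (R \<inter> R') = int DIM('a) - 1"

text \<open>Reflection in the linear span of a set S (used when span S is a hyperplane):
  reflection along a nonzero normal vector of span S.\<close>
definition hyperplane_reflection :: "'a::euclidean_space set \<Rightarrow> 'a \<Rightarrow> 'a" where
  "hyperplane_reflection S v =
     (let n = (SOME n. n \<noteq> 0 \<and> (\<forall>x \<in> span S. inner n x = 0))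
      in v - (2 * inner v n / inner n n) *\<^sub>R n)"

definition refl_adj :: "'a::euclidean_space set \<Rightarrow> 'a set \<Rightarrow> 'a \<Rightarrow> 'a" where
  "refl_adj R R' = hyperplane_reflection (R \<inter> R')"

definition is_walk :: "'a::euclidean_space set set \<Rightarrow> 'a set list \<Rightarrow> bool" where
  "is_walk \<F> W \<longleftrightarrow> W \<noteq> [] \<and> set W \<subseteq> regions \<F> \<and>
     (\<forall>i. Suc i < length W \<longrightarrow> adjacent \<F> (W ! i) (W ! Suc i))"

fun walk_map :: "'a::euclidean_space set list \<Rightarrow> 'a \<Rightarrow> 'a" where
  "walk_map [] = id"
| "walk_map [R] = id"
| "walk_map (R # R' # W) = walk_map (R' # W) \<circ> refl_adj R' R"

text \<open>Based inscribed space (the lineality space of the fans considered here is {0}).\<close>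
definition InSpc :: "'a::euclidean_space set set \<Rightarrow> 'a set \<Rightarrow> 'a set" where
  "InSpc \<F> R0 = {v. \<forall>W. is_walk \<F> W \<and> hd W = R0 \<and> last W = R0 \<longrightarrow> walk_map W v = v}"

text \<open>Polytopes are embedded linearly (w.r.t. Minkowski sum and dilation) via their
  support functions into the real vector space of functions 'a \<Rightarrow> real.\<close>
definition support_fun :: "'a::euclidean_space set \<Rightarrow> 'a \<Rightarrow> real" where
  "support_fun Q = (\<lambda>u. Sup ((\<lambda>x. inner u x) ` Q))"

definition fscale :: "real \<Rightarrow> ('a \<Rightarrow> real) \<Rightarrow> ('a \<Rightarrow> real)" where
  "fscale c f = (\<lambda>u. c * f u)"

definition fdim :: "('a \<Rightarrow> real) set \<Rightarrow> nat" where
  "fdim S = vector_space.dim fscale S"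

text \<open>Support functions of translations (points).\<close>
definition translation_funs :: "('a::euclidean_space \<Rightarrow> real) set" where
  "translation_funs = {(\<lambda>u. inner u t) | t. True}"

definition inscribed_realizations :: "'a::euclidean_space set \<Rightarrow> 'a set set" where
  "inscribed_realizations P = {Q. inscribed Q \<and> normal_fan Q = normal_fan P}"

text \<open>dim InCone(P): dimension of the image of the inscribed realisations in the
  quotient of the support-function space by the translations, i.e.
  dim (span(H + T)) - dim T.\<close>
definition InCone_dim :: "'a::euclidean_space set \<Rightarrow> nat" where
  "InCone_dim P = fdim (support_fun ` inscribed_realizations P \<union> translation_funs)
                  - fdim (translation_funs :: ('a \<Rightarrow> real) set)"

end

theory Submission
  imports Defs
begin

text \<open>An inscribed realization, centred at the origin, is a family of points y v, one for each vertex v of P,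
  such that y w is the mirror image of y v in the hyperplane orthogonal to w - v for every edge vw, subject to
  finitely many open conditions saying that the edges keep their orientation. Such a family is determined by its
  value at a base vertex, which ranges over the based inscribed space; hence the dimension of the inscribed cone
  is that of the based inscribed space, and it is d iff the reflections admit a consistent system of orthogonal
  frames on the vertices. The sign of the determinant of the frames is a proper 2-colouring of the edge graph,
  so all polygons are even. Conversely, frames on an even polytope are constructed vertex by vertex, ordered by a
  generic linear functional u: two lower edges at a vertex that span a common 2-face give the same frame because
  going around that 2-face is a rotation with too many fixed points, and any two lower edges are joined by
  a chain of 2-faces that stays below.\<close>

section \<open>Faces of dimension one higher\<close>

text \<open>The assumed inscribed realization is used twice. Its family \<open>y\<close> satisfies
  the strict conditions \<open>y v \<bullet> (w - v) < 0\<close>, so the admissible base values form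
  a nonempty relatively open part of the based inscribed space and therefore span it. And since
  \<open>y v\<close> is not orthogonal to the edges at v, it supplies the one fixed direction beyond
  the orthogonal complement of a 2-face; without it, an even product of reflections around the
  2-face could be a nontrivial rotation. All combinatorics of P comes from one local fact: if a
  linear functional is constant on a face but larger somewhere on P, then it is larger somewhere on
  a face one dimension higher. For a vertex this yields an improving edge, hence connectedness of
  the edge graph; for an edge it yields the 2-faces that link lower edges, in place of a theory of
  vertex figures. In the dimension count a polytope is its support function, which is linear on each
  region. Pairs of a centre and a base value map linearly, and for full-dimensional P injectively,
  to such functions, so the translations account for exactly the dimension of the ambient
  space.\<close>

lemma direction_in_kernel_not_in_subspace:
  fixes D E :: "'a::euclidean_space set"
  assumes D: "subspace D" and E: "subspace E" and dims: "dim E + 2 \<le> dim D"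
  shows "\<exists>z\<in>D. u \<bullet> z = 0 \<and> z \<notin> E"
proof -
  let ?N = "{x. u \<bullet> x = 0}"
  have N: "subspace ?N" by (rule subspace_hyperplane)
  have "DIM('a) \<le> dim ?N + 1"
    by (cases "u = 0") (auto simp: dim_hyperplane)
  moreover have "dim {x + y |x y. x \<in> D \<and> y \<in> ?N} + dim (D \<inter> ?N) = dim D + dim ?N"
    by (rule dim_sums_Int[OF D N])
  moreover have "dim {x + y |x y. x \<in> D \<and> y \<in> ?N} \<le> DIM('a)" by (rule dim_subset_UNIV)
  ultimately have "dim E < dim (D \<inter> ?N)" using dims by linarith
  then have "\<not> D \<inter> ?N \<subseteq> E" using dim_subset not_le by blast
  then show ?thesis by blast
qed

text \<open>A tight constraint survives every step along \<open>q\<close>, a slack one survives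
  short steps, and finitely many constraints leave a common positive step length.\<close>

lemma halfspaces_feasible_direction:
  fixes A :: "'i \<Rightarrow> 'a::euclidean_space"
  assumes "finite H" and v: "\<And>h. h \<in> H \<Longrightarrow> A h \<bullet> v \<le> B h"
    and q: "\<And>h. h \<in> H \<Longrightarrow> A h \<bullet> v = B h \<Longrightarrow> A h \<bullet> q \<le> 0"
  shows "\<exists>e>0. \<forall>h\<in>H. A h \<bullet> (v + e *\<^sub>R q) \<le> B h"
proof -
  have "\<exists>e>0. \<forall>d>0. d < e \<longrightarrow> A h \<bullet> (v + d *\<^sub>R q) \<le> B h" if h: "h \<in> H" for h
  proof (cases "A h \<bullet> v = B h")
    case True
    then show ?thesis using q[OF h True]
      by (intro exI[of _ 1]) (auto simp: inner_right_distrib mult_nonneg_nonpos)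
  next
    case False
    then have s: "B h - A h \<bullet> v > 0" using v[OF h] by simp
    have "A h \<bullet> (v + d *\<^sub>R q) \<le> B h"
      if d: "0 < d" "d < (B h - A h \<bullet> v) / (1 + \<bar>A h \<bullet> q\<bar>)" for d
    proof -
      have "d * (A h \<bullet> q) \<le> d * (1 + \<bar>A h \<bullet> q\<bar>)" using d by (intro mult_left_mono) auto
      also have "\<dots> \<le> B h - A h \<bullet> v" using d by (simp add: pos_less_divide_eq)
      finally show ?thesis by (simp add: inner_right_distrib)
    qed
    moreover have "(B h - A h \<bullet> v) / (1 + \<bar>A h \<bullet> q\<bar>) > 0" using s by (simp add: add_pos_nonneg)
    ultimately show ?thesis by blast
  qed
  then have "\<forall>\<^sub>F d in at_right 0. A h \<bullet> (v + d *\<^sub>R q) \<le> B h" if "h \<in> H" for h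
    unfolding eventually_at_right_field using that by simp
  then have "\<forall>\<^sub>F d in at_right (0::real). \<forall>h\<in>H. A h \<bullet> (v + d *\<^sub>R q) \<le> B h"
    using \<open>finite H\<close> by (intro eventually_ball_finite) auto
  then obtain b where b: "b > 0" "\<forall>d>0. d < b \<longrightarrow> (\<forall>h\<in>H. A h \<bullet> (v + d *\<^sub>R q) \<le> B h)"
    unfolding eventually_at_right_field by auto
  have "\<forall>h\<in>H. A h \<bullet> (v + (b/2) *\<^sub>R q) \<le> B h"
    using b(1) by (intro ballI b(2)[rule_format]) auto
  then show ?thesis using half_gt_zero[OF b(1)] by blast
qed

text \<open>The direction w - v is tilted, without changing its \<open>u\<close>-value, into the
  boundary of the tangent cone of P at v. Codimension at least 2 leaves a direction \<open>z\<close>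
  in the kernel of \<open>u\<close> that is not along F, and moving w along \<open>z\<close> hits
  the hyperplane of a constraint tight at v; that hyperplane cuts out K.\<close>

lemma proper_face_with_improving_point:
  fixes P :: "'a::euclidean_space set"
  assumes P: "polytope P" and F: "F face_of P" and v: "v \<in> rel_interior F"
    and w: "w \<in> P" "u \<bullet> v < u \<bullet> w" and dims: "aff_dim F + 2 \<le> aff_dim P"
  shows "\<exists>K. K face_of P \<and> K \<noteq> P \<and> F \<subseteq> K \<and> (\<exists>x\<in>K. u \<bullet> v < u \<bullet> x)"
proof -
  define D where "D = span ((\<lambda>x. x - v) ` P)"
  define E where "E = span ((\<lambda>x. x - v) ` F)"
  have vF: "v \<in> F" using v rel_interior_subset by blast
  have vP: "v \<in> P" using vF F face_of_imp_subset by blast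
  have "dim E + 2 \<le> dim D"
    using dims by (simp add: D_def E_def dim_span aff_dim_eq_dim_subtract[of v] hull_inc vF vP)
  then obtain z0 where z0: "z0 \<in> D" "u \<bullet> z0 = 0" "z0 \<notin> E"
    using direction_in_kernel_not_in_subspace[of D E u] D_def E_def subspace_span by blast
  obtain H where H: "finite H" "P = \<Inter>H" "\<forall>h\<in>H. \<exists>a b. a \<noteq> 0 \<and> h = {x. a \<bullet> x \<le> b}"
    using polytope_imp_polyhedron[OF P] unfolding polyhedron_def by blast
  have "\<forall>h\<in>H. \<exists>a b. \<forall>x. x \<in> h \<longleftrightarrow> a \<bullet> x \<le> b" using H(3) by fast
  then obtain A B where AB: "\<And>h x. h \<in> H \<Longrightarrow> x \<in> h \<longleftrightarrow> A h \<bullet> x \<le> B h" by metis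
  have PH: "x \<in> P \<longleftrightarrow> (\<forall>h\<in>H. A h \<bullet> x \<le> B h)" for x
    by (simp add: H(2) AB)
  have vh: "A h \<bullet> v \<le> B h" if "h \<in> H" for h using PH vP that by blast
  have feas: "\<exists>e>0. v + e *\<^sub>R q \<in> P"
    if "\<And>h. h \<in> H \<Longrightarrow> A h \<bullet> v = B h \<Longrightarrow> A h \<bullet> q \<le> 0" for q
    using halfspaces_feasible_direction[OF H(1) vh that] unfolding PH .
  \<comment> \<open>If every constraint tight at v were constant along \<open>z0\<close>, P would
    contain a segment with v in its interior in direction \<open>z0\<close>; its ends would lie in
    the face F, contradicting \<open>z0 \<notin> E\<close>.\<close>
  have "\<exists>h\<in>H. A h \<bullet> v = B h \<and> A h \<bullet> z0 \<noteq> 0"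
  proof (rule ccontr)
    assume "\<not> ?thesis"
    then have tz: "\<And>h. h \<in> H \<Longrightarrow> A h \<bullet> v = B h \<Longrightarrow> A h \<bullet> z0 = 0" by blast
    have "\<exists>e>0. v + e *\<^sub>R z0 \<in> P" by (rule feas) (simp add: tz)
    then obtain e1 where e1: "e1 > 0" "v + e1 *\<^sub>R z0 \<in> P" by blast
    have "\<exists>e>0. v + e *\<^sub>R (- z0) \<in> P" by (rule feas) (simp add: tz)
    then obtain e2 where e2: "e2 > 0" "v + e2 *\<^sub>R (- z0) \<in> P" by blast
    have z00: "z0 \<noteq> 0" using z0(3) by (auto simp: E_def span_zero)
    have "v \<in> open_segment (v + e1 *\<^sub>R z0) (v + e2 *\<^sub>R (- z0))"
    proof -
      have "(1 - e1/(e1+e2)) *\<^sub>R (v + e1 *\<^sub>R z0) + (e1/(e1+e2)) *\<^sub>R (v + e2 *\<^sub>R (- z0))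
         = v + ((1 - e1/(e1+e2)) * e1 - (e1/(e1+e2)) * e2) *\<^sub>R z0"
        by (simp add: algebra_simps)
      also have "(1 - e1/(e1+e2)) * e1 - (e1/(e1+e2)) * e2 = 0"
        using e1 e2 by (simp add: field_simps)
      finally have "v = (1 - e1/(e1+e2)) *\<^sub>R (v + e1 *\<^sub>R z0) + (e1/(e1+e2)) *\<^sub>R (v + e2 *\<^sub>R (- z0))"
        by simp
      moreover have "0 < e1/(e1+e2)" "e1/(e1+e2) < 1" using e1 e2 by auto
      moreover have "v + e1 *\<^sub>R z0 \<noteq> v + e2 *\<^sub>R (- z0)"
      proof
        assume "v + e1 *\<^sub>R z0 = v + e2 *\<^sub>R (- z0)"
        then have "(e1 + e2) *\<^sub>R z0 = 0" by (simp add: algebra_simps)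
        then show False using z00 e1 e2 by auto
      qed
      ultimately show ?thesis unfolding in_segment by (intro conjI exI[of _ "e1/(e1+e2)"])
    qed
    then have "v + e1 *\<^sub>R z0 \<in> F"
      using face_ofD[OF F] e1(2) e2(2) vF by blast
    then have "(v + e1 *\<^sub>R z0) - v \<in> E" unfolding E_def by (intro span_base) blast
    then have "(1/e1) *\<^sub>R (v + e1 *\<^sub>R z0 - v) \<in> E" unfolding E_def by (rule span_mul)
    then show False using z0(3) e1 by simp
  qed
  then obtain h1 where h1: "h1 \<in> H" "A h1 \<bullet> v = B h1" "A h1 \<bullet> z0 \<noteq> 0" by blast
  obtain z where z: "z \<in> D" "u \<bullet> z = 0" "A h1 \<bullet> z > 0"
  proof (cases "A h1 \<bullet> z0 > 0")
    case True then show ?thesis using that z0 by blast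
  next
    case False then show ?thesis using that[of "- z0"] z0 h1 by (simp add: D_def span_neg)
  qed
  \<comment> \<open>\<open>s h\<close> is the time at which w, moving along \<open>z\<close>, meets
    the hyperplane of \<open>h\<close>, and \<open>h0\<close> is hit first. Only constraints tight
    at v compete, so \<open>p\<close> may lie outside P, but a short step from v towards
    \<open>p\<close> stays inside.\<close>
  define T where "T = {h \<in> H. A h \<bullet> v = B h \<and> A h \<bullet> z > 0}"
  define s where "s = (\<lambda>h. (B h - A h \<bullet> w) / (A h \<bullet> z))"
  have "finite T" "T \<noteq> {}" using H(1) h1 z unfolding T_def by auto
  define h0 where "h0 = arg_min_on s T"
  have h0: "h0 \<in> T" and h0min: "\<And>h. h \<in> T \<Longrightarrow> s h0 \<le> s h"
    using arg_min_if_finite[OF \<open>finite T\<close> \<open>T \<noteq> {}\<close>, of s] unfolding h0_def by (auto simp: not_less)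
  have h0': "h0 \<in> H" "A h0 \<bullet> v = B h0" "A h0 \<bullet> z > 0" using h0 unfolding T_def by auto
  have wh: "A h \<bullet> w \<le> B h" if "h \<in> H" for h using PH w that by blast
  have s0: "s h0 \<ge> 0" unfolding s_def using h0' wh[of h0] by simp
  define p where "p = w + s h0 *\<^sub>R z"
  have p_h0: "A h0 \<bullet> p = B h0"
    using h0' by (simp add: p_def inner_right_distrib s_def)
  have p_le: "A h \<bullet> p \<le> B h" if h: "h \<in> H" "A h \<bullet> v = B h" for h
  proof (cases "A h \<bullet> z > 0")
    case True
    then have "s h0 \<le> s h" using h0min h unfolding T_def by blast
    then have "s h0 * (A h \<bullet> z) \<le> s h * (A h \<bullet> z)" using True by (simp add: mult_right_mono)
    also have "\<dots> = B h - A h \<bullet> w" using True by (simp add: s_def)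
    finally show ?thesis by (simp add: p_def inner_right_distrib)
  next
    case False
    then have "s h0 * (A h \<bullet> z) \<le> 0" using s0 by (simp add: mult_nonneg_nonpos)
    then show ?thesis using wh[OF h(1)] by (simp add: p_def inner_right_distrib)
  qed
  have "\<exists>e>0. v + e *\<^sub>R (p - v) \<in> P"
    by (rule feas) (use p_le in \<open>force simp: inner_diff_right\<close>)
  then obtain e where e: "e > 0" "v + e *\<^sub>R (p - v) \<in> P" by blast
  define K where "K = P \<inter> {x. A h0 \<bullet> x = B h0}"
  have "K face_of P" unfolding K_def
    by (rule face_of_Int_supporting_hyperplane_le) (use P PH h0' in \<open>auto simp: polytope_imp_convex\<close>)
  moreover have "F \<subseteq> K"
    by (rule subset_of_face_of[OF \<open>K face_of P\<close> face_of_imp_subset[OF F]])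
       (use v vP h0' in \<open>auto simp: K_def\<close>)
  moreover have "K \<noteq> P"
  proof
    assume "K = P"
    then have "(\<lambda>x. x - v) ` P \<subseteq> {y. A h0 \<bullet> y = 0}"
      using h0' unfolding K_def by (auto simp: inner_diff_right)
    then have "D \<subseteq> {y. A h0 \<bullet> y = 0}" unfolding D_def
      by (intro span_minimal subspace_hyperplane)
    then show False using z h0' by auto
  qed
  moreover have "v + e *\<^sub>R (p - v) \<in> K"
    using e p_h0 h0' by (simp add: K_def inner_right_distrib inner_diff_right)
  moreover have "u \<bullet> v < u \<bullet> (v + e *\<^sub>R (p - v))"
    using e w z by (simp add: inner_right_distrib inner_diff_right p_def)
  ultimately show ?thesis by blast
qed

text \<open>Induction on the dimension of P: unless P itself is one dimension above F, some proper
  face still contains F together with a point above the level \<open>t\<close>.\<close>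

lemma face_lift:
  fixes P :: "'a::euclidean_space set"
  assumes "polytope P" and "F face_of P" and const: "\<And>x. x \<in> F \<Longrightarrow> u \<bullet> x = t"
    and "F \<noteq> {}" and "\<exists>x\<in>P. t < u \<bullet> x"
  shows "\<exists>G. G face_of P \<and> F \<subseteq> G \<and> aff_dim G = aff_dim F + 1 \<and> (\<exists>x\<in>G. t < u \<bullet> x)"
  using assms(1,2,5)
proof (induction "nat (aff_dim P)" arbitrary: P rule: less_induct)
  case less
  note F = less.prems(2)
  have convF: "convex F" using F face_of_imp_convex by blast
  obtain v where v: "v \<in> rel_interior F"
    using \<open>F \<noteq> {}\<close> rel_interior_eq_empty[OF convF] by blast
  have uv: "u \<bullet> v = t" by (rule const) (use v rel_interior_subset in blast)
  have cP: "convex P" using less.prems(1) polytope_imp_convex by blast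
  obtain w where w: "w \<in> P" "t < u \<bullet> w" using less.prems(3) by blast
  have "F \<noteq> P" using w const[of w] by force
  then have lt: "aff_dim F < aff_dim P" using face_of_aff_dim_lt[OF cP F] by blast
  have F0: "aff_dim F \<ge> 0" using \<open>F \<noteq> {}\<close> aff_dim_negative_iff[of F] by linarith
  show ?case
  proof (cases "aff_dim P = aff_dim F + 1")
    case True
    then show ?thesis
      using w face_of_imp_subset[OF F] face_of_refl[OF cP] by (intro exI[of _ P]) blast
  next
    case False
    then have "aff_dim F + 2 \<le> aff_dim P" using lt by linarith
    then obtain K where K: "K face_of P" "K \<noteq> P" "F \<subseteq> K" "\<exists>x\<in>K. t < u \<bullet> x"
      using proper_face_with_improving_point[OF less.prems(1) F v w(1), of u] w(2) unfolding uv by blast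
    have "aff_dim K < aff_dim P" using face_of_aff_dim_lt[OF cP K(1,2)] .
    then have "nat (aff_dim K) < nat (aff_dim P)" using F0 lt by linarith
    moreover have "polytope K" using face_of_polytope_polytope[OF less.prems(1) K(1)] .
    moreover have "F face_of K" using F K(1,3) face_of_face by blast
    ultimately obtain G where G: "G face_of K" "F \<subseteq> G" "aff_dim G = aff_dim F + 1"
        "\<exists>x\<in>G. t < u \<bullet> x"
      using less.hyps[of K] K(4) by blast
    then show ?thesis using face_of_trans[OF G(1) K(1)] by blast
  qed
qed

section \<open>Vertices, edges and polygons\<close>

definition is_edge :: "'a::euclidean_space set \<Rightarrow> 'a \<Rightarrow> 'a \<Rightarrow> bool" where
  "is_edge P v w \<longleftrightarrow> v \<noteq> w \<and> closed_segment v w face_of P"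

lemma vertices_iff_face: "v \<in> vertices P \<longleftrightarrow> {v} face_of P"
  by (simp add: vertices_def face_of_singleton)

lemma vertices_subset: "vertices P \<subseteq> P"
  by (auto simp: vertices_def extreme_point_of_def)

lemma finite_vertices:
  fixes P :: "'a::euclidean_space set"
  shows "polytope P \<Longrightarrow> finite (vertices P)"
  unfolding vertices_def
  using finite_polyhedron_extreme_points polytope_imp_polyhedron by blast

lemma convex_hull_vertices:
  fixes P :: "'a::euclidean_space set"
  shows "polytope P \<Longrightarrow> convex hull (vertices P) = P"
  unfolding vertices_def
  using Krein_Milman_Minkowski polytope_imp_compact polytope_imp_convex by blast

lemma vertices_nonempty:
  fixes P :: "'a::euclidean_space set"
  shows "polytope P \<Longrightarrow> P \<noteq> {} \<Longrightarrow> vertices P \<noteq> {}"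
  using convex_hull_vertices by fastforce

lemma vertices_of_face: "F face_of P \<Longrightarrow> vertices F = vertices P \<inter> F"
  by (auto simp: vertices_def extreme_point_of_face)

lemma is_edge_sym: "is_edge P v w \<longleftrightarrow> is_edge P w v"
  by (auto simp: is_edge_def closed_segment_commute)

lemma vertices_closed_segment:
  fixes a b :: "'a::euclidean_space"
  shows "vertices (closed_segment a b) = {a, b}"
  unfolding vertices_def by (simp add: extreme_point_of_segment set_eq_iff)

lemma is_edge_vertices:
  assumes "is_edge P v w"
  shows "v \<in> vertices P" "w \<in> vertices P"
  using assms vertices_of_face[of "closed_segment v w" P]
  by (auto simp: is_edge_def vertices_closed_segment)

lemma is_edge_of_face:
  assumes F: "F face_of P"
  shows "is_edge F v w \<longleftrightarrow> is_edge P v w \<and> v \<in> F \<and> w \<in> F"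
proof -
  have "convex F" using F face_of_imp_convex by blast
  then have "closed_segment v w \<subseteq> F \<longleftrightarrow> v \<in> F \<and> w \<in> F"
    using closed_segment_subset by (metis ends_in_segment subsetD)
  then show ?thesis using face_of_face[OF F] unfolding is_edge_def by blast
qed

lemma inner_le_of_vertices:
  fixes P :: "'a::euclidean_space set"
  assumes "polytope P" and "\<And>w. w \<in> vertices P \<Longrightarrow> c \<bullet> w \<le> b" and x: "x \<in> P"
  shows "c \<bullet> x \<le> b"
proof -
  have "convex hull (vertices P) \<subseteq> {x. c \<bullet> x \<le> b}"
    by (rule hull_minimal) (use assms convex_halfspace_le in auto)
  then show ?thesis using x convex_hull_vertices[OF assms(1)] by blast
qed

lemma one_dimensional_face_with_vertex:
  fixes P :: "'a::euclidean_space set"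
  assumes P: "polytope P" and G: "G face_of P" "aff_dim G = 1" and v: "v \<in> vertices P" "v \<in> G"
  shows "\<exists>w. is_edge P v w \<and> G = closed_segment v w"
proof -
  have pG: "polytope G" using face_of_polytope_polytope[OF P G(1)] .
  have "collinear G" using G(2) by (simp add: collinear_aff_dim)
  moreover have "G \<noteq> {}" using v by blast
  ultimately obtain a b where ab: "G = closed_segment a b"
    using compact_convex_collinear_segment[of G] polytope_imp_compact[OF pG] polytope_imp_convex[OF pG]
    by blast
  have "v \<in> vertices G" using v vertices_of_face[OF G(1)] by blast
  then have "v = a \<or> v = b" by (simp add: ab vertices_closed_segment)
  then obtain w where w: "G = closed_segment v w" using ab closed_segment_commute by blast
  have "v \<noteq> w" using G(2) w by auto
  then show ?thesis using w G(1) unfolding is_edge_def by blast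
qed

text \<open>The optimality criterion of the simplex method, obtained from \<open>face_lift\<close>
  at the face \<open>{v}\<close>.\<close>

lemma improving_edge:
  fixes P :: "'a::euclidean_space set"
  assumes P: "polytope P" and v: "v \<in> vertices P" and x: "x \<in> P" "u \<bullet> v < u \<bullet> x"
  shows "\<exists>w. is_edge P v w \<and> u \<bullet> v < u \<bullet> w"
proof -
  have "\<exists>G. G face_of P \<and> {v} \<subseteq> G \<and> aff_dim G = aff_dim {v} + 1 \<and> (\<exists>x\<in>G. u \<bullet> v < u \<bullet> x)"
    by (rule face_lift[OF P]) (use v x in \<open>auto simp: vertices_iff_face\<close>)
  then obtain G y where G: "G face_of P" "v \<in> G" "aff_dim G = 1" and y: "y \<in> G" "u \<bullet> v < u \<bullet> y"
    by auto
  obtain w where w: "is_edge P v w" "G = closed_segment v w"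
    using one_dimensional_face_with_vertex[OF P G(1,3) v G(2)] by (elim exE conjE) (rule that)
  have "y \<in> closed_segment v w" using y(1) unfolding w(2) .
  then obtain s where s: "0 \<le> s" "y = (1 - s) *\<^sub>R v + s *\<^sub>R w" unfolding in_segment by auto
  have "s * (u \<bullet> w - u \<bullet> v) > 0" using y(2) by (simp add: s(2) inner_right_distrib algebra_simps)
  then have "u \<bullet> v < u \<bullet> w" using s(1) by (simp add: zero_less_mult_iff)
  then show ?thesis using w(1) by blast
qed

lemma improving_two_face:
  fixes P :: "'a::euclidean_space set"
  assumes P: "polytope P" and a: "is_edge P v a" "u \<bullet> a = u \<bullet> v" and x: "x \<in> P" "u \<bullet> v < u \<bullet> x"
  shows "\<exists>G b. G face_of P \<and> aff_dim G = 2 \<and> is_edge G v a \<and> is_edge G v b \<and> u \<bullet> v < u \<bullet> b"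
proof -
  have "u \<bullet> y = u \<bullet> v" if y: "y \<in> closed_segment v a" for y
  proof -
    obtain s where s: "y = (1 - s) *\<^sub>R v + s *\<^sub>R a" using y unfolding in_segment by blast
    show ?thesis unfolding s by (simp add: inner_right_distrib a(2) left_diff_distrib)
  qed
  note const = this
  have dim1: "aff_dim (closed_segment v a) = 1"
    using a(1) by (simp add: is_edge_def segment_convex_hull aff_dim_convex_hull aff_dim_2)
  have face: "closed_segment v a face_of P" using a(1) by (simp add: is_edge_def)
  have "\<exists>y\<in>P. u \<bullet> v < u \<bullet> y" using x by blast
  from face_lift[OF P face const _ this] obtain G where G: "G face_of P"
      "closed_segment v a \<subseteq> G" "aff_dim G = aff_dim (closed_segment v a) + 1"
      and y: "\<exists>y\<in>G. u \<bullet> v < u \<bullet> y"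
    by force
  have dimG: "aff_dim G = 2" using G(3) dim1 by simp
  have va: "v \<in> G" "a \<in> G" using G(2) by auto
  have pG: "polytope G" using face_of_polytope_polytope[OF P G(1)] .
  have va': "is_edge G v a" using is_edge_of_face[OF G(1)] a(1) va by blast
  obtain b where "is_edge G v b" "u \<bullet> v < u \<bullet> b"
    using improving_edge[OF pG is_edge_vertices(1)[OF va']] y by blast
  then show ?thesis using G(1) dimG va' by blast
qed

lemma face_exposing_functional:
  fixes P :: "'a::euclidean_space set"
  assumes P: "polytope P" and F: "F face_of P"
  shows "\<exists>c b. (\<forall>x\<in>P. c \<bullet> x \<le> b) \<and> F = {x \<in> P. c \<bullet> x = b}"
proof -
  have "F exposed_face_of P"
    using F exposed_face_of_polyhedron polytope_imp_polyhedron[OF P] by blast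
  then show ?thesis unfolding exposed_face_of_def by blast
qed

lemma vertex_exposing_functional:
  fixes P :: "'a::euclidean_space set"
  assumes P: "polytope P" and v: "v \<in> vertices P"
  shows "\<exists>c. \<forall>x\<in>P. x \<noteq> v \<longrightarrow> c \<bullet> x < c \<bullet> v"
proof -
  obtain c b where c: "\<forall>x\<in>P. c \<bullet> x \<le> b" "{v} = {x \<in> P. c \<bullet> x = b}"
    using face_exposing_functional[OF P] v unfolding vertices_iff_face by blast
  have "c \<bullet> v = b" using c(2) by blast
  moreover have "c \<bullet> x \<noteq> b" if "x \<in> P" "x \<noteq> v" for x using c(2) that by blast
  ultimately show ?thesis using c(1) by (intro exI[of _ c]) (auto simp: order.strict_iff_order)
qed

lemma edge_exposing_functional:
  fixes P :: "'a::euclidean_space set"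
  assumes P: "polytope P" and a: "is_edge P v a"
  shows "\<exists>c. c \<bullet> a = c \<bullet> v \<and> (\<forall>b\<in>vertices P. b \<noteq> a \<longrightarrow> b \<noteq> v \<longrightarrow> c \<bullet> b < c \<bullet> v)"
proof -
  have f: "closed_segment v a face_of P" using a by (simp add: is_edge_def)
  obtain c t where c: "\<forall>x\<in>P. c \<bullet> x \<le> t" "closed_segment v a = {x \<in> P. c \<bullet> x = t}"
    using face_exposing_functional[OF P f] by blast
  have t: "c \<bullet> v = t" "c \<bullet> a = t" using c(2) by auto
  have "c \<bullet> b < c \<bullet> v" if b: "b \<in> vertices P" "b \<noteq> a" "b \<noteq> v" for b
  proof -
    have "b \<in> P" using b(1) vertices_subset by blast
    have "b \<notin> closed_segment v a"
    proof
      assume "b \<in> closed_segment v a"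
      then have "b \<in> vertices (closed_segment v a)" using b(1) vertices_of_face[OF f] by blast
      then show False using b by (simp add: vertices_closed_segment)
    qed
    then have "c \<bullet> b \<noteq> t" using c(2) \<open>b \<in> P\<close> by blast
    then show ?thesis using c(1) \<open>b \<in> P\<close> t by (simp add: order.strict_iff_order)
  qed
  then show ?thesis using t by (intro exI[of _ c]) auto
qed

lemma linear_relation_of_three_in_plane:
  fixes p q r :: "'a::euclidean_space"
  assumes S: "subspace S" "dim S = 2" and pqr: "p \<in> S" "q \<in> S" "r \<in> S"
  shows "\<exists>x y z. (x \<noteq> 0 \<or> y \<noteq> 0 \<or> z \<noteq> 0) \<and> x *\<^sub>R p + y *\<^sub>R q + z *\<^sub>R r = 0"
\<comment> \<open>Coinciding vectors shrink the set \<open>{p, q, r}\<close>, so they get an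
  explicit relation.\<close>
proof (cases "p = q \<or> p = r \<or> q = r")
  case True
  then consider "p = q" | "p = r" | "q = r" by blast
  then show ?thesis
  proof cases
    case 1 then show ?thesis by (intro exI[of _ 1] exI[of _ "-1"] exI[of _ 0]) simp
  next
    case 2 then show ?thesis by (intro exI[of _ 1] exI[of _ 0] exI[of _ "-1"]) simp
  next
    case 3 then show ?thesis by (intro exI[of _ 0] exI[of _ 1] exI[of _ "-1"]) simp
  qed
next
  case False
  then have card: "card {p, q, r} = 3" by simp
  have "dependent {p, q, r}"
  proof (rule ccontr)
    assume "independent {p, q, r}"
    then have "card {p, q, r} \<le> dim S" using independent_card_le_dim[of "{p,q,r}" S] pqr by simp
    then show False using card S by simp
  qed
  then obtain u where u: "\<exists>v\<in>{p, q, r}. u v \<noteq> 0" "(\<Sum>v\<in>{p, q, r}. u v *\<^sub>R v) = 0"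
    using real_vector.dependent_finite[of "{p, q, r}"] by auto
  have "u p *\<^sub>R p + u q *\<^sub>R q + u r *\<^sub>R r = 0" using u(2) False by (simp add: add.assoc)
  then show ?thesis using u(1) by blast
qed

text \<open>A functional in the plane of G that is constant on one edge finds the second. Three
  edges are impossible: their directions satisfy a linear relation, and the exposing functional of
  each edge forces the coefficients of the other two to have opposite signs or both to vanish, which
  cannot hold for all three pairs unless the relation is trivial.\<close>

lemma polygon_vertex_degree:
  fixes G :: "'a::euclidean_space set"
  assumes G: "polytope G" "aff_dim G = 2" and v: "v \<in> vertices G"
  shows "card {w. is_edge G v w} = 2"
proof -
  have vG: "v \<in> G" using v vertices_subset by blast
  define D where "D = span ((\<lambda>x. x - v) ` G)"
  have D: "subspace D" "dim D = 2"
    using G(2) aff_dim_eq_dim_subtract[of v G] hull_inc[OF vG, of affine] by (auto simp: D_def dim_span)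
  have inD: "x - v \<in> D" if "x \<in> G" for x unfolding D_def using that by (intro span_base) blast
  have nbG: "w \<in> G" if "is_edge G v w" for w using is_edge_vertices(2)[OF that] vertices_subset by blast
  have "\<not> G \<subseteq> {v}"
  proof
    assume "G \<subseteq> {v}" then have "G = {v}" using vG by blast
    then show False using G(2) by simp
  qed
  then obtain x where x: "x \<in> G" "x \<noteq> v" by blast
  have "(x - v) \<bullet> (x - v) > 0" using x by simp
  then have "(x - v) \<bullet> v < (x - v) \<bullet> x" by (simp add: inner_diff_right)
  then obtain a where a: "is_edge G v a" using improving_edge[OF G(1) v x(1)] by blast
  have "\<exists>z\<in>D. (a - v) \<bullet> z = 0 \<and> z \<notin> {0}"
    by (rule direction_in_kernel_not_in_subspace) (use D in auto)
  then obtain z where z: "z \<in> D" "(a - v) \<bullet> z = 0" "z \<noteq> 0" by blast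
  have "\<exists>y\<in>G. z \<bullet> y \<noteq> z \<bullet> v"
  proof (rule ccontr)
    assume "\<not> ?thesis"
    then have "(\<lambda>x. x - v) ` G \<subseteq> {y. z \<bullet> y = 0}" by (auto simp: inner_diff_right)
    then have "D \<subseteq> {y. z \<bullet> y = 0}" unfolding D_def by (intro span_minimal subspace_hyperplane)
    then show False using z by auto
  qed
  then obtain y where y: "y \<in> G" "z \<bullet> y \<noteq> z \<bullet> v" by blast
  define u where "u = (if z \<bullet> y > z \<bullet> v then z else - z)"
  have u: "u \<bullet> v < u \<bullet> y" "u \<bullet> a = u \<bullet> v"
    using y(2) z(2) by (auto simp: u_def inner_diff_left inner_commute[of a] inner_commute[of v])
  obtain b where b: "is_edge G v b" "u \<bullet> v < u \<bullet> b" using improving_edge[OF G(1) v y(1) u(1)] by blast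
  have ab: "a \<noteq> b" using b u by auto
  have "w = a \<or> w = b" if w: "is_edge G v w" for w
  proof (rule ccontr)
    assume ne: "\<not> (w = a \<or> w = b)"
    obtain s t r where rel: "s \<noteq> 0 \<or> t \<noteq> 0 \<or> r \<noteq> 0"
        "s *\<^sub>R (a - v) + t *\<^sub>R (b - v) + r *\<^sub>R (w - v) = 0"
      using linear_relation_of_three_in_plane[OF D inD inD inD] nbG[OF a] nbG[OF b(1)] nbG[OF w] by metis
    have rel': "s * (c \<bullet> (a - v)) + t * (c \<bullet> (b - v)) + r * (c \<bullet> (w - v)) = 0" for c
      using arg_cong[OF rel(2), of "inner c"] by (simp add: inner_right_distrib)
    have nv: "a \<noteq> v" "b \<noteq> v" "w \<noteq> v" using a b w by (auto simp: is_edge_def)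
    note vs = is_edge_vertices(2)[OF a] is_edge_vertices(2)[OF b(1)] is_edge_vertices(2)[OF w]
    have opp: "x * y < 0 \<or> x = 0 \<and> y = 0"
      if "x * A + y * B = 0" "A < 0" "B < 0" for x y A B :: real
    proof (cases x "0::real" rule: linorder_cases)
      case less
      then have "y * B < 0" using that mult_neg_neg[of x A] by linarith
      then show ?thesis using less \<open>B < 0\<close> by (simp add: mult_less_0_iff)
    next
      case equal
      then show ?thesis using that by simp
    next
      case greater
      then have "y * B > 0" using that mult_pos_neg[of x A] by linarith
      then show ?thesis using greater \<open>B < 0\<close> by (simp add: mult_less_0_iff zero_less_mult_iff)
    qed
    obtain c1 where "c1 \<bullet> a = c1 \<bullet> v" "c1 \<bullet> b < c1 \<bullet> v" "c1 \<bullet> w < c1 \<bullet> v"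
      using edge_exposing_functional[OF G(1) a] vs ne ab nv by metis
    then have 1: "t * r < 0 \<or> t = 0 \<and> r = 0"
      using opp[of t "c1 \<bullet> (b - v)" r "c1 \<bullet> (w - v)"] rel'[of c1] by (simp add: inner_diff_right)
    obtain c2 where "c2 \<bullet> b = c2 \<bullet> v" "c2 \<bullet> a < c2 \<bullet> v" "c2 \<bullet> w < c2 \<bullet> v"
      using edge_exposing_functional[OF G(1) b(1)] vs ne ab nv by metis
    then have 2: "s * r < 0 \<or> s = 0 \<and> r = 0"
      using opp[of s "c2 \<bullet> (a - v)" r "c2 \<bullet> (w - v)"] rel'[of c2] by (simp add: inner_diff_right)
    obtain c3 where "c3 \<bullet> w = c3 \<bullet> v" "c3 \<bullet> a < c3 \<bullet> v" "c3 \<bullet> b < c3 \<bullet> v"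
      using edge_exposing_functional[OF G(1) w] vs ne ab nv by metis
    then have 3: "s * t < 0 \<or> s = 0 \<and> t = 0"
      using opp[of s "c3 \<bullet> (a - v)" t "c3 \<bullet> (b - v)"] rel'[of c3] by (simp add: inner_diff_right)
    show False using 1 2 3 rel(1) by (auto simp: mult_less_0_iff)
  qed
  then have "{w. is_edge G v w} = {a, b}" using a b by blast
  then show ?thesis using ab by simp
qed

section \<open>The normal fan and its walls\<close>

lemma finite_ascent_induct [consumes 2, case_names step]:
  fixes f :: "'a \<Rightarrow> real"
  assumes "finite A" and "a \<in> A"
    and step: "\<And>a. a \<in> A \<Longrightarrow> (\<And>b. b \<in> A \<Longrightarrow> f a < f b \<Longrightarrow> Q b) \<Longrightarrow> Q a"
  shows "Q a"
  using \<open>a \<in> A\<close>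
proof (induction "card {b \<in> A. f a < f b}" arbitrary: a rule: less_induct)
  case less
  show ?case
  proof (rule step[OF less.prems])
    fix b assume b: "b \<in> A" "f a < f b"
    have "{x \<in> A. f b < f x} \<subset> {x \<in> A. f a < f x}" using b by force
    then have "card {x \<in> A. f b < f x} < card {x \<in> A. f a < f x}"
      using \<open>finite A\<close> by (intro psubset_card_mono) auto
    then show "Q b" using less.hyps b(1) by blast
  qed
qed

section \<open>Generic functionals and the normal cones of vertices\<close>

lemma eq_of_inner_eq_on_open:
  fixes x y :: "'a::euclidean_space"
  assumes "open U" "U \<noteq> {}" and "\<And>c. c \<in> U \<Longrightarrow> c \<bullet> x = c \<bullet> y"
  shows "x = y"
proof (rule ccontr)
  assume "x \<noteq> y"
  then have "aff_dim {c. (x - y) \<bullet> c = 0} = int DIM('a) - 1" by (simp add: aff_dim_hyperplane)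
  moreover have "U \<subseteq> {c. (x - y) \<bullet> c = 0}"
    using assms(3) by (auto simp: inner_diff_left inner_diff_right inner_commute)
  moreover have "aff_dim U = int DIM('a)" using aff_dim_open[OF assms(1,2)] .
  ultimately show False using aff_dim_subset[of U "{c. (x - y) \<bullet> c = 0}"] by simp
qed

lemma generic_functional:
  fixes S :: "'a::euclidean_space set"
  assumes "finite S" and "open U" "U \<noteq> {}" and "0 \<notin> S"
  shows "\<exists>c\<in>U. \<forall>z\<in>S. c \<bullet> z \<noteq> 0"
  using assms
proof (induction S arbitrary: U rule: finite_induct)
  case empty
  then show ?case by blast
next
  case (insert z S)
  have "open (U \<inter> - {c. z \<bullet> c = 0})"
    using insert.prems by (intro open_Int open_Compl closed_hyperplane)
  moreover have "U \<inter> - {c. z \<bullet> c = 0} \<noteq> {}"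
  proof
    assume "U \<inter> - {c. z \<bullet> c = 0} = {}"
    then have "z = 0" using eq_of_inner_eq_on_open[of U z 0] insert.prems(1,2)
      by (auto simp: inner_commute)
    then show False using insert.prems by simp
  qed
  ultimately obtain c where "c \<in> U \<inter> - {c. z \<bullet> c = 0}" "\<forall>y\<in>S. c \<bullet> y \<noteq> 0"
    using insert.IH[of "U \<inter> - {c. z \<bullet> c = 0}"] insert.prems by auto
  then show ?case by (intro bexI[of _ c]) (auto simp: inner_commute)
qed

lemma open_halfspaces_finite:
  fixes v :: "'a::euclidean_space"
  assumes "finite S"
  shows "open {c. \<forall>w\<in>S. c \<bullet> w < c \<bullet> v}"
proof -
  have "{c. \<forall>w\<in>S. c \<bullet> w < c \<bullet> v} = (\<Inter>w\<in>S. {c. (w - v) \<bullet> c < 0})"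
    by (auto simp: inner_diff_left inner_diff_right inner_commute)
  then show ?thesis using assms by (simp add: open_INT open_halfspace_lt)
qed

text \<open>For a vertex v this is the interior of \<open>normal_cone P {v}\<close>; finitely many
  strict inequalities make it visibly open.\<close>

definition strict_cone :: "'a::euclidean_space set \<Rightarrow> 'a \<Rightarrow> 'a set" where
  "strict_cone P v = {c. \<forall>w\<in>vertices P - {v}. c \<bullet> w < c \<bullet> v}"

lemma open_strict_cone: "polytope P \<Longrightarrow> open (strict_cone P v)"
  unfolding strict_cone_def by (intro open_halfspaces_finite finite_Diff finite_vertices)

lemma strict_cone_nonempty:
  assumes "polytope P" "v \<in> vertices P"
  shows "strict_cone P v \<noteq> {}"
  using vertex_exposing_functional[OF assms] vertices_subset[of P]
  unfolding strict_cone_def by blast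

lemma mem_normal_cone_vertex:
  assumes "polytope P" "v \<in> vertices P"
  shows "c \<in> normal_cone P {v} \<longleftrightarrow> (\<forall>w\<in>vertices P. c \<bullet> w \<le> c \<bullet> v)"
proof
  assume "\<forall>w\<in>vertices P. c \<bullet> w \<le> c \<bullet> v"
  then show "c \<in> normal_cone P {v}"
    using inner_le_of_vertices[OF assms(1), of c "c \<bullet> v"] by (simp add: normal_cone_def)
qed (use vertices_subset[of P] in \<open>auto simp: normal_cone_def\<close>)

lemma strict_cone_subset:
  assumes "polytope P" "v \<in> vertices P"
  shows "strict_cone P v \<subseteq> normal_cone P {v}"
  using mem_normal_cone_vertex[OF assms] unfolding strict_cone_def by (auto simp: less_imp_le) (metis Diff_iff less_eq_real_def singletonD)

lemma strict_cone_unique: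
  assumes P: "polytope P" and "v \<in> vertices P" "w \<in> vertices P"
    and c: "c \<in> strict_cone P v" "c \<in> normal_cone P {w}"
  shows "w = v"
proof (rule ccontr)
  assume "w \<noteq> v"
  then have "c \<bullet> w < c \<bullet> v" using c(1) assms(3) by (simp add: strict_cone_def)
  moreover have "c \<bullet> v \<le> c \<bullet> w" using c(2) mem_normal_cone_vertex[OF P assms(3)] assms(2) by blast
  ultimately show False by simp
qed

lemma normal_cone_vertex_inj:
  assumes P: "polytope P" and v: "v \<in> vertices P" and w: "w \<in> vertices P"
    and eq: "normal_cone P {v} = normal_cone P {w}"
  shows "v = w"
proof -
  obtain c where c: "c \<in> strict_cone P v" using strict_cone_nonempty[OF P v] by blast
  then have "c \<in> normal_cone P {w}" using strict_cone_subset[OF P v] eq by blast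
  then show ?thesis using strict_cone_unique[OF P v w c] by simp
qed

lemma aff_dim_normal_cone_vertex:
  fixes P :: "'a::euclidean_space set"
  assumes "polytope P" "v \<in> vertices P"
  shows "aff_dim (normal_cone P {v}) = int DIM('a)"
proof -
  have "aff_dim (strict_cone P v) = int DIM('a)"
    by (rule aff_dim_open[OF open_strict_cone[OF assms(1)] strict_cone_nonempty[OF assms]])
  then show ?thesis
    using aff_dim_subset[OF strict_cone_subset[OF assms]] aff_dim_le_DIM[of "normal_cone P {v}"] by simp
qed

text \<open>Two distinct points of a face make every functional in its normal cone orthogonal to
  their difference, so only vertices have full-dimensional cones; the cone of a vertex contains a
  nonempty open set.\<close>

lemma regions_normal_fan:
  fixes P :: "'a::euclidean_space set"
  assumes P: "polytope P"
  shows "regions (normal_fan P) = (\<lambda>v. normal_cone P {v}) ` vertices P"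
proof (intro equalityI subsetI)
  fix R assume "R \<in> regions (normal_fan P)"
  then obtain F where F: "F face_of P" "F \<noteq> {}" "R = normal_cone P F" and R: "aff_dim R = int DIM('a)"
    unfolding regions_def normal_fan_def by blast
  obtain v where v: "v \<in> F" using F(2) by blast
  have FP: "F \<subseteq> P" using F(1) face_of_imp_subset by blast
  have "x = v" if x: "x \<in> F" for x
  proof (rule ccontr)
    assume "x \<noteq> v"
    then have "aff_dim {c. (x - v) \<bullet> c = 0} = int DIM('a) - 1" by (simp add: aff_dim_hyperplane)
    moreover have "R \<subseteq> {c. (x - v) \<bullet> c = 0}"
    proof
      fix c assume "c \<in> R"
      then have "c \<bullet> x \<le> c \<bullet> v" "c \<bullet> v \<le> c \<bullet> x"
        using x v FP unfolding F(3) normal_cone_def by blast+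
      then show "c \<in> {c. (x - v) \<bullet> c = 0}" by (simp add: inner_diff_left inner_diff_right inner_commute)
    qed
    ultimately show False using aff_dim_subset[of R "{c. (x - v) \<bullet> c = 0}"] R by simp
  qed
  then have "F = {v}" using v by blast
  then show "R \<in> (\<lambda>v. normal_cone P {v}) ` vertices P"
    using F(1,3) by (simp add: vertices_iff_face)
next
  fix R assume "R \<in> (\<lambda>v. normal_cone P {v}) ` vertices P"
  then obtain v where v: "v \<in> vertices P" "R = normal_cone P {v}" by blast
  then show "R \<in> regions (normal_fan P)"
    using aff_dim_normal_cone_vertex[OF P v(1)] unfolding regions_def normal_fan_def
    by (auto simp: vertices_iff_face)
qed

lemma max_face:
  fixes P :: "'a::euclidean_space set" and c :: 'a
  assumes P: "polytope P" "P \<noteq> {}"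
  defines "F \<equiv> {x \<in> P. \<forall>y\<in>P. c \<bullet> y \<le> c \<bullet> x}"
  shows "F face_of P" "F \<noteq> {}"
proof -
  have "continuous_on P (\<lambda>x. c \<bullet> x)" by (intro continuous_intros)
  then obtain v where v: "v \<in> P" "\<forall>y\<in>P. c \<bullet> y \<le> c \<bullet> v"
    using continuous_attains_sup[OF polytope_imp_compact[OF P(1)] P(2)] by blast
  have "F = P \<inter> {x. c \<bullet> x = c \<bullet> v}" using v unfolding F_def by force
  then show "F face_of P"
    using face_of_Int_supporting_hyperplane_le[OF polytope_imp_convex[OF P(1)], of c "c \<bullet> v"] v(2) by simp
  show "F \<noteq> {}" using v unfolding F_def by blast
qed

lemma normal_cone_max_face:
  fixes P :: "'a::euclidean_space set" and c :: 'a
  assumes P: "polytope P" "P \<noteq> {}"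
  defines "F \<equiv> {x \<in> P. \<forall>y\<in>P. c \<bullet> y \<le> c \<bullet> x}"
  shows "normal_cone P F = \<Inter>{R \<in> regions (normal_fan P). c \<in> R}"
proof -
  have F: "F face_of P" "F \<noteq> {}" using max_face[OF P, of c] unfolding F_def by auto
  have pF: "polytope F" using face_of_polytope_polytope[OF P(1) F(1)] .
  have vF: "v \<in> vertices F \<longleftrightarrow> v \<in> vertices P \<and> c \<in> normal_cone P {v}" for v
    using vertices_of_face[OF F(1)] vertices_subset[of P] by (auto simp: F_def normal_cone_def)
  have reg: "{R \<in> regions (normal_fan P). c \<in> R} = (\<lambda>v. normal_cone P {v}) ` vertices F"
    unfolding regions_normal_fan[OF P(1)] using vF by blast
  have "d \<in> normal_cone P F \<longleftrightarrow> (\<forall>v\<in>vertices F. d \<in> normal_cone P {v})" for d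
  proof
    assume "d \<in> normal_cone P F"
    then show "\<forall>v\<in>vertices F. d \<in> normal_cone P {v}"
      using vertices_subset[of F] unfolding normal_cone_def by blast
  next
    assume d: "\<forall>v\<in>vertices F. d \<in> normal_cone P {v}"
    have "d \<bullet> y \<le> d \<bullet> x" if "x \<in> F" "y \<in> P" for x y
      using inner_le_of_vertices[OF pF, of "- d" "- (d \<bullet> y)" x] d that by (auto simp: normal_cone_def)
    then show "d \<in> normal_cone P F" by (simp add: normal_cone_def)
  qed
  then show ?thesis unfolding reg by blast
qed

text \<open>Every cone of the fan is the intersection of the regions that contain a functional
  exposing its face. A fan is thus determined by its regions, and comparing two fans reduces to
  comparing cones of vertices.\<close>

lemma normal_fan_eq_of_regions:
  fixes P :: "'a::euclidean_space set"
  assumes P: "polytope P" "P \<noteq> {}"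
  shows "normal_fan P = range (\<lambda>c. \<Inter>{R \<in> regions (normal_fan P). c \<in> R})"
proof (intro equalityI subsetI)
  fix N assume "N \<in> normal_fan P"
  then obtain F where F: "F face_of P" "F \<noteq> {}" "N = normal_cone P F"
    unfolding normal_fan_def by blast
  obtain c b where c: "\<forall>x\<in>P. c \<bullet> x \<le> b" "F = {x \<in> P. c \<bullet> x = b}"
    using face_exposing_functional[OF P(1) F(1)] by (elim exE conjE) (rule that)
  have "F = {x \<in> P. \<forall>y\<in>P. c \<bullet> y \<le> c \<bullet> x}"
    using c F(2) by force
  then have "N = \<Inter>{R \<in> regions (normal_fan P). c \<in> R}"
    using normal_cone_max_face[OF P, of c] F(3) by simp
  then show "N \<in> range (\<lambda>c. \<Inter>{R \<in> regions (normal_fan P). c \<in> R})" by (rule range_eqI)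
next
  fix N assume "N \<in> range (\<lambda>c. \<Inter>{R \<in> regions (normal_fan P). c \<in> R})"
  then obtain c where "N = \<Inter>{R \<in> regions (normal_fan P). c \<in> R}" by (elim rangeE)
  then have "N = normal_cone P {x \<in> P. \<forall>y\<in>P. c \<bullet> y \<le> c \<bullet> x}"
    using normal_cone_max_face[OF P, of c] by simp
  then show "N \<in> normal_fan P" using max_face[OF P, of c] unfolding normal_fan_def by blast
qed

lemma normal_fan_eqI:
  fixes P Q :: "'a::euclidean_space set"
  assumes "polytope P" "P \<noteq> {}" "polytope Q" "Q \<noteq> {}"
    and "regions (normal_fan Q) = regions (normal_fan P)"
  shows "normal_fan Q = normal_fan P"
  using normal_fan_eq_of_regions[OF assms(1,2)] normal_fan_eq_of_regions[OF assms(3,4)] assms(5) by simp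

text \<open>Reflection in the hyperplane orthogonal to \<open>n\<close>, with an explicit normal
  instead of a chosen one. Division by zero makes \<open>reflect 0\<close> the identity, so the map
  is orthogonal for every \<open>n\<close>.\<close>

definition reflect :: "'a::euclidean_space \<Rightarrow> 'a \<Rightarrow> 'a" where
  "reflect n x = x - (2 * (x \<bullet> n) / (n \<bullet> n)) *\<^sub>R n"

lemma orthogonal_transformation_reflect: "orthogonal_transformation (reflect n)"
proof (cases "n = 0")
  case True
  then have "reflect n = (\<lambda>x. x)" by (auto simp: reflect_def)
  then show ?thesis by (simp add: orthogonal_transformation_id)
next
  case False
  have "linear (reflect n)"
    by (rule linearI) (auto simp: reflect_def algebra_simps add_divide_distrib)
  moreover have "reflect n x \<bullet> reflect n y = x \<bullet> y" for x y
  proof -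
    have "reflect n x \<bullet> reflect n y = x \<bullet> y - (2 * (y \<bullet> n) / (n \<bullet> n)) * (x \<bullet> n)
      - (2 * (x \<bullet> n) / (n \<bullet> n)) * (y \<bullet> n) + (2 * (x \<bullet> n) / (n \<bullet> n)) * (2 * (y \<bullet> n) / (n \<bullet> n)) * (n \<bullet> n)"
      by (simp add: reflect_def inner_diff_left inner_diff_right inner_commute algebra_simps)
    also have "\<dots> = x \<bullet> y" using False by (simp add: field_simps)
    finally show ?thesis .
  qed
  ultimately show ?thesis unfolding orthogonal_transformation_def by blast
qed

lemma reflect_scaleR: "k \<noteq> 0 \<Longrightarrow> reflect (k *\<^sub>R n) x = reflect n x"
  by (simp add: reflect_def)

lemma reflect_minus_commute: "reflect (v - w) = reflect (w - v)"
  using reflect_scaleR[of "-1" "w - v"] by (auto simp: fun_eq_iff)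

lemma reflect_orthogonal: "x \<bullet> n = 0 \<Longrightarrow> reflect n x = x"
  by (simp add: reflect_def)

lemma reflect_reflect: "reflect n (reflect n x) = x"
  by (cases "n = 0") (simp_all add: reflect_def inner_diff_left)

lemma parallel_of_orthogonal_hyperplane:
  fixes m n :: "'a::euclidean_space"
  assumes "\<And>x. n \<bullet> x = 0 \<Longrightarrow> m \<bullet> x = 0"
  shows "m = ((m \<bullet> n) / (n \<bullet> n)) *\<^sub>R n"
proof -
  define r where "r = m - ((m \<bullet> n) / (n \<bullet> n)) *\<^sub>R n"
  have "n \<bullet> r = 0" by (cases "n = 0") (simp_all add: r_def inner_diff_right inner_commute)
  then have "m \<bullet> r = 0" using assms by blast
  then have "r \<bullet> r = 0" using \<open>n \<bullet> r = 0\<close>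
    by (metis (no_types, lifting) r_def inner_diff_left inner_scaleR_left diff_zero mult_zero_right)
  then show ?thesis by (simp add: r_def)
qed

text \<open>The normal picked by \<open>SOME\<close> is a nonzero multiple of \<open>n\<close>, and
  rescaling a normal does not change the reflection.\<close>

lemma hyperplane_reflection_eq_reflect:
  fixes n :: "'a::euclidean_space"
  assumes n: "n \<noteq> 0" and S: "span S = {x. n \<bullet> x = 0}"
  shows "hyperplane_reflection S = reflect n"
proof -
  define m where "m = (SOME m. m \<noteq> 0 \<and> (\<forall>x\<in>span S. m \<bullet> x = 0))"
  have "n \<noteq> 0 \<and> (\<forall>x\<in>span S. n \<bullet> x = 0)" using n S by simp
  then have "m \<noteq> 0 \<and> (\<forall>x\<in>span S. m \<bullet> x = 0)" unfolding m_def by (rule someI)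
  then have m: "m \<noteq> 0" "\<And>x. n \<bullet> x = 0 \<Longrightarrow> m \<bullet> x = 0" using S by auto
  define k where "k = (m \<bullet> n) / (n \<bullet> n)"
  have mk: "m = k *\<^sub>R n" unfolding k_def by (rule parallel_of_orthogonal_hyperplane[OF m(2)])
  have "k \<noteq> 0" using m(1) mk by auto
  have "hyperplane_reflection S x = reflect m x" for x
    unfolding hyperplane_reflection_def Let_def m_def[symmetric] reflect_def ..
  then show ?thesis using reflect_scaleR[OF \<open>k \<noteq> 0\<close>, of n] mk by (simp add: fun_eq_iff)
qed

section \<open>Walls between regions correspond to edges\<close>

lemma normal_cones_inter_subset:
  assumes "v \<in> P" "w \<in> P"
  shows "normal_cone P {v} \<inter> normal_cone P {w} \<subseteq> {c. (w - v) \<bullet> c = 0}"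
proof
  fix c assume "c \<in> normal_cone P {v} \<inter> normal_cone P {w}"
  then have "c \<bullet> w \<le> c \<bullet> v" "c \<bullet> v \<le> c \<bullet> w" using assms by (auto simp: normal_cone_def)
  then show "c \<in> {c. (w - v) \<bullet> c = 0}" by (simp add: inner_diff_left inner_diff_right inner_commute)
qed

text \<open>The exposing functional of the edge satisfies all other vertex inequalities strictly. So
  the intersection of the cones contains a nonempty relatively open part of the hyperplane
  orthogonal to the edge.\<close>

lemma aff_dim_normal_cones_inter_edge:
  fixes P :: "'a::euclidean_space set"
  assumes P: "polytope P" and e: "is_edge P v w"
  shows "aff_dim (normal_cone P {v} \<inter> normal_cone P {w}) = int DIM('a) - 1"
proof -
  have v: "v \<in> vertices P" and w: "w \<in> vertices P" using is_edge_vertices[OF e] by auto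
  have vw: "v \<noteq> w" using e by (simp add: is_edge_def)
  let ?H = "{c. (w - v) \<bullet> c = 0}"
  let ?U = "{c. \<forall>b\<in>vertices P - {v, w}. c \<bullet> b < c \<bullet> v}"
  have dimH: "aff_dim ?H = int DIM('a) - 1" using vw by (simp add: aff_dim_hyperplane)
  have oU: "open ?U" by (intro open_halfspaces_finite finite_Diff finite_vertices P)
  obtain c where c: "c \<bullet> w = c \<bullet> v" "\<forall>b\<in>vertices P. b \<noteq> w \<longrightarrow> b \<noteq> v \<longrightarrow> c \<bullet> b < c \<bullet> v"
    using edge_exposing_functional[OF P e] by blast
  have "c \<in> ?H \<inter> ?U" using c by (auto simp: inner_diff_left inner_diff_right inner_commute)
  then have "?H \<inter> ?U \<noteq> {}" by (metis empty_iff)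
  then have "affine hull (?H \<inter> ?U) = affine hull ?H"
    by (rule affine_hull_affine_Int_open[OF affine_hyperplane oU])
  then have "aff_dim (?H \<inter> ?U) = int DIM('a) - 1"
    using dimH aff_dim_affine_hull[of "?H \<inter> ?U"] aff_dim_affine_hull[of ?H] by simp
  moreover have "?H \<inter> ?U \<subseteq> normal_cone P {v} \<inter> normal_cone P {w}"
  proof
    fix d assume d: "d \<in> ?H \<inter> ?U"
    then have dw: "d \<bullet> w = d \<bullet> v" by (simp add: inner_diff_left inner_diff_right inner_commute)
    have "d \<bullet> b \<le> d \<bullet> v" if "b \<in> vertices P" for b
      using d dw that by (cases "b = v \<or> b = w") (auto simp: less_imp_le)
    then show "d \<in> normal_cone P {v} \<inter> normal_cone P {w}"
      using mem_normal_cone_vertex[OF P v] mem_normal_cone_vertex[OF P w] dw by simp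
  qed
  moreover have "normal_cone P {v} \<inter> normal_cone P {w} \<subseteq> ?H"
    using normal_cones_inter_subset v w vertices_subset by blast
  ultimately show ?thesis using dimH
    by (metis (no_types, lifting) aff_dim_subset order_antisym)
qed

lemma span_normal_cones_inter:
  fixes P :: "'a::euclidean_space set"
  assumes "v \<in> P" "w \<in> P" "v \<noteq> w"
    and dim: "aff_dim (normal_cone P {v} \<inter> normal_cone P {w}) = int DIM('a) - 1"
  shows "span (normal_cone P {v} \<inter> normal_cone P {w}) = {c. (w - v) \<bullet> c = 0}"
proof -
  let ?K = "normal_cone P {v} \<inter> normal_cone P {w}"
  let ?H = "{c. (w - v) \<bullet> c = 0}"
  have "0 \<in> ?K" by (simp add: normal_cone_def)
  then have "int (dim ?K) = int DIM('a) - 1" using dim by (simp add: aff_dim_zero hull_inc)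
  moreover have "int (dim ?H) = int DIM('a) - 1"
    using assms(3) by (simp add: dim_hyperplane of_nat_diff DIM_positive Suc_le_eq)
  ultimately have "dim ?H \<le> dim ?K" by simp
  then have "span ?K = span ?H"
    by (intro dim_eq_span normal_cones_inter_subset[OF assms(1,2)])
  then show ?thesis using subspace_hyperplane[of "w - v"] by (simp add: span_eq_iff)
qed

text \<open>From regions to edges: the points where every functional of the wall takes the value it
  has at v form a face F. The wall spans the hyperplane orthogonal to w - v, so F lies on the line
  through v and w, and containing both it must be an edge.\<close>

lemma adjacent_normal_fan_iff:
  fixes P :: "'a::euclidean_space set"
  assumes P: "polytope P" and v: "v \<in> vertices P" and w: "w \<in> vertices P"
  shows "adjacent (normal_fan P) (normal_cone P {v}) (normal_cone P {w}) \<longleftrightarrow> is_edge P v w"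
proof
  assume "is_edge P v w"
  then show "adjacent (normal_fan P) (normal_cone P {v}) (normal_cone P {w})"
    unfolding adjacent_def regions_normal_fan[OF P] using v w aff_dim_normal_cones_inter_edge[OF P] by simp
next
  let ?K = "normal_cone P {v} \<inter> normal_cone P {w}"
  assume "adjacent (normal_fan P) (normal_cone P {v}) (normal_cone P {w})"
  then have dim: "aff_dim ?K = int DIM('a) - 1" by (simp add: adjacent_def)
  have vP: "v \<in> P" and wP: "w \<in> P" using v w vertices_subset by blast+
  have vw: "v \<noteq> w" using dim aff_dim_normal_cone_vertex[OF P v] by auto
  have span: "span ?K = {c. (w - v) \<bullet> c = 0}" by (rule span_normal_cones_inter[OF vP wP vw dim])
  define F where "F = \<Inter>((\<lambda>c. P \<inter> {x. c \<bullet> x = c \<bullet> v}) ` ?K)"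
  have "0 \<in> ?K" by (simp add: normal_cone_def)
  have F: "F face_of P" unfolding F_def
  proof (rule face_of_Inter)
    show "(\<lambda>c. P \<inter> {x. c \<bullet> x = c \<bullet> v}) ` ?K \<noteq> {}" using \<open>0 \<in> ?K\<close> by blast
    fix T assume "T \<in> (\<lambda>c. P \<inter> {x. c \<bullet> x = c \<bullet> v}) ` ?K"
    then obtain c where c: "c \<in> ?K" "T = P \<inter> {x. c \<bullet> x = c \<bullet> v}" by (elim imageE)
    show "T face_of P" unfolding c(2)
      by (rule face_of_Int_supporting_hyperplane_le[OF polytope_imp_convex[OF P]])
         (use c(1) in \<open>auto simp: normal_cone_def\<close>)
  qed
  have KH: "c \<bullet> w = c \<bullet> v" if "c \<in> ?K" for c
    using normal_cones_inter_subset[OF vP wP] that by (auto simp: inner_diff_left inner_diff_right inner_commute)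
  have vF: "v \<in> F" unfolding F_def using vP by blast
  have wF: "w \<in> F" unfolding F_def using wP KH by blast
  have "F \<subseteq> affine hull {v, w}"
  proof
    fix x assume x: "x \<in> F"
    have "c \<bullet> x = c \<bullet> v" if "c \<in> ?K" for c using x that unfolding F_def by blast
    then have "?K \<subseteq> {c. (x - v) \<bullet> c = 0}"
      by (auto simp: inner_diff_left inner_diff_right inner_commute)
    then have "span ?K \<subseteq> {c. (x - v) \<bullet> c = 0}" by (intro span_minimal subspace_hyperplane)
    then have "x - v = (((x - v) \<bullet> (w - v)) / ((w - v) \<bullet> (w - v))) *\<^sub>R (w - v)"
      using span by (intro parallel_of_orthogonal_hyperplane) blast
    then obtain t where "x - v = t *\<^sub>R (w - v)" by blast
    then have "x = (1 - t) *\<^sub>R v + t *\<^sub>R w" by (simp add: algebra_simps)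
    then show "x \<in> affine hull {v, w}" unfolding affine_hull_2 by (intro CollectI exI[of _ "1 - t"] exI[of _ t]) simp
  qed
  then have "aff_dim F \<le> aff_dim {v, w}" by (metis aff_dim_affine_hull aff_dim_subset)
  moreover have "aff_dim {v, w} \<le> aff_dim F" using vF wF by (intro aff_dim_subset) simp
  ultimately have dimF: "aff_dim F = 1" using vw by (simp add: aff_dim_2)
  obtain b where b: "is_edge P v b" "F = closed_segment v b"
    using one_dimensional_face_with_vertex[OF P F dimF v vF] by (elim exE conjE) (rule that)
  have "w \<in> vertices F" using w wF vertices_of_face[OF F] by simp
  then have "w = b" using vw unfolding b(2) vertices_closed_segment by simp
  then show "is_edge P v w" using b(1) by simp
qed

lemma refl_adj_normal_cones:
  fixes P :: "'a::euclidean_space set"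
  assumes P: "polytope P" and e: "is_edge P v w"
  shows "refl_adj (normal_cone P {v}) (normal_cone P {w}) = reflect (w - v)"
proof -
  have "v \<in> P" "w \<in> P" using is_edge_vertices[OF e] vertices_subset by blast+
  moreover have "v \<noteq> w" using e by (simp add: is_edge_def)
  ultimately show ?thesis unfolding refl_adj_def
    by (intro hyperplane_reflection_eq_reflect span_normal_cones_inter
          aff_dim_normal_cones_inter_edge[OF P e]) auto
qed

section \<open>Edge families and inscribed realizations\<close>

text \<open>Improving edges lead from every vertex to the unique maximiser v of \<open>c\<close>;
  the property is carried backwards along such a path. This is the form in which connectedness of
  the edge graph is used.\<close>

lemma improving_path_induct:
  fixes P :: "'a::euclidean_space set"
  assumes P: "polytope P" and v: "v \<in> vertices P" and c: "c \<in> strict_cone P v"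
    and w: "w \<in> vertices P" and base: "Q v"
    and step: "\<And>a b. is_edge P a b \<Longrightarrow> c \<bullet> a < c \<bullet> b \<Longrightarrow> Q b \<Longrightarrow> Q a"
  shows "Q w"
  using finite_vertices[OF P] w
proof (induction rule: finite_ascent_induct[where f = "\<lambda>x. c \<bullet> x"])
  case (step a)
  show ?case
  proof (cases "a = v")
    case True then show ?thesis using base by simp
  next
    case False
    then have lt: "c \<bullet> a < c \<bullet> v" using c step.hyps by (simp add: strict_cone_def)
    have "v \<in> P" using v vertices_subset by blast
    then obtain b where b: "is_edge P a b" "c \<bullet> a < c \<bullet> b"
      using improving_edge[OF P step.hyps _ lt] by blast
    then show ?thesis using assms(6)[OF b] step.IH is_edge_vertices(2) by blast
  qed
qed

definition edge_family :: "'a::euclidean_space set \<Rightarrow> ('a \<Rightarrow> 'a) \<Rightarrow> bool" where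
  "edge_family P y \<longleftrightarrow> (\<forall>v w. is_edge P v w \<longrightarrow> y w = reflect (w - v) (y v))"

lemma edge_familyD: "edge_family P y \<Longrightarrow> is_edge P v w \<Longrightarrow> y w = reflect (w - v) (y v)"
  by (simp add: edge_family_def)

lemma norm_reflect: "norm (reflect n x) = norm x"
  using orthogonal_transformation_reflect orthogonal_transformation by blast

lemma norm_edge_family:
  fixes P :: "'a::euclidean_space set"
  assumes P: "polytope P" and y: "edge_family P y" and "v \<in> vertices P" "w \<in> vertices P"
  shows "norm (y w) = norm (y v)"
proof -
  obtain c where c: "c \<in> strict_cone P v" using strict_cone_nonempty[OF P assms(3)] by blast
  show ?thesis
  proof (rule improving_path_induct[OF P assms(3) c assms(4), of "\<lambda>w. norm (y w) = norm (y v)"])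
    fix a b assume "is_edge P a b" "norm (y b) = norm (y v)"
    then show "norm (y a) = norm (y v)" using edge_familyD[OF y] norm_reflect by metis
  qed simp
qed

section \<open>Walks in the dual graph and their products of reflections\<close>

lemma is_walk_singleton: "is_walk \<F> [R] \<longleftrightarrow> R \<in> regions \<F>"
  by (simp add: is_walk_def)

lemma is_walk_Cons_Cons: "is_walk \<F> (R # R' # W) \<longleftrightarrow> adjacent \<F> R R' \<and> is_walk \<F> (R' # W)"
proof -
  have "(\<forall>i. Suc i < length (R # R' # W) \<longrightarrow> adjacent \<F> ((R # R' # W) ! i) ((R # R' # W) ! Suc i))
    \<longleftrightarrow> adjacent \<F> R R' \<and> (\<forall>i. Suc i < length (R' # W) \<longrightarrow> adjacent \<F> ((R' # W) ! i) ((R' # W) ! Suc i))"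
    (is "(\<forall>i. ?A i) \<longleftrightarrow> _")
  proof -
    have "(\<forall>i. ?A i) \<longleftrightarrow> ?A 0 \<and> (\<forall>i. ?A (Suc i))" by (metis not0_implies_Suc)
    then show ?thesis by simp
  qed
  then show ?thesis unfolding is_walk_def by (auto simp: adjacent_def)
qed

lemma is_walk_append:
  assumes "is_walk \<F> W" "is_walk \<F> (last W # W')"
  shows "is_walk \<F> (W @ W') \<and> hd (W @ W') = hd W \<and> last (W @ W') = last (last W # W')
    \<and> walk_map (W @ W') = walk_map (last W # W') \<circ> walk_map W"
  using assms
proof (induction W rule: induct_list012)
  case 1
  then show ?case by (simp add: is_walk_def)
next
  case (2 R)
  then show ?case by simp
next
  case (3 R R' W)
  then have "is_walk \<F> (R' # W)" by (simp add: is_walk_Cons_Cons)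
  moreover have "is_walk \<F> (last (R' # W) # W')" using "3.prems"(2) by simp
  ultimately have IH: "is_walk \<F> ((R' # W) @ W') \<and> hd ((R' # W) @ W') = hd (R' # W)
    \<and> last ((R' # W) @ W') = last (last (R' # W) # W')
    \<and> walk_map ((R' # W) @ W') = walk_map (last (R' # W) # W') \<circ> walk_map (R' # W)"
    by (rule "3.IH"(2))
  moreover have "last (R # R' # W) = last (R' # W)" "last ((R # R' # W) @ W') = last ((R' # W) @ W')"
    by simp_all
  moreover have "adjacent \<F> R R'" using "3.prems"(1) by (simp add: is_walk_Cons_Cons)
  moreover have "walk_map ((R # R' # W) @ W') = walk_map ((R' # W) @ W') \<circ> refl_adj R' R"
    "walk_map (R # R' # W) = walk_map (R' # W) \<circ> refl_adj R' R" by simp_all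
  moreover have "is_walk \<F> ((R # R' # W) @ W') \<longleftrightarrow> adjacent \<F> R R' \<and> is_walk \<F> ((R' # W) @ W')"
    by (simp add: is_walk_Cons_Cons)
  ultimately show ?case by (simp only: comp_assoc list.sel append_Cons simp_thms)
qed

lemma orthogonal_transformation_walk_map: "orthogonal_transformation (walk_map W)"
proof (induction W rule: induct_list012)
  case (3 R R' W)
  \<comment> \<open>This holds for any two sets, adjacent or not, so \<open>walk_map\<close> of an
    arbitrary list is orthogonal.\<close>
  have "refl_adj R' R = reflect (SOME n. n \<noteq> 0 \<and> (\<forall>x\<in>span (R' \<inter> R). inner n x = 0))"
    by (simp add: fun_eq_iff refl_adj_def hyperplane_reflection_def Let_def reflect_def)
  then show ?case unfolding walk_map.simps
    by (simp only:) (rule orthogonal_transformation_compose[OF "3.IH"(2) orthogonal_transformation_reflect])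
qed (simp_all add: orthogonal_transformation_id id_def)

lemma walk_map_edge_family:
  fixes P :: "'a::euclidean_space set"
  assumes P: "polytope P" and y: "edge_family P y"
    and "is_walk (normal_fan P) W" "hd W = normal_cone P {a}" "last W = normal_cone P {b}"
    and "a \<in> vertices P" "b \<in> vertices P"
  shows "walk_map W (y a) = y b"
  using assms(3-6)
proof (induction W arbitrary: a rule: induct_list012)
  case 1
  then show ?case by (simp add: is_walk_def)
next
  case (2 R)
  then have "a = b" using normal_cone_vertex_inj[OF P _ assms(7)] by simp
  then show ?case by simp
next
  case (3 R R' W)
  have adj: "adjacent (normal_fan P) R R'" and W: "is_walk (normal_fan P) (R' # W)"
    using "3.prems"(1) by (simp_all add: is_walk_Cons_Cons)
  then have "R' \<in> (\<lambda>v. normal_cone P {v}) ` vertices P"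
    using regions_normal_fan[OF P] by (simp add: adjacent_def)
  then obtain a' where a': "a' \<in> vertices P" "R' = normal_cone P {a'}" by (elim imageE)
  have R: "R = normal_cone P {a}" using "3.prems"(2) by simp
  have e: "is_edge P a a'" using adj adjacent_normal_fan_iff[OF P "3.prems"(4) a'(1)] a'(2) R by simp
  have "refl_adj R' R = reflect (a - a')"
    using refl_adj_normal_cones[OF P, of a' a] e by (simp add: is_edge_sym a'(2) R)
  then have "walk_map (R # R' # W) (y a) = walk_map (R' # W) (reflect (a' - a) (y a))"
    by (simp add: reflect_minus_commute)
  also have "\<dots> = walk_map (R' # W) (y a')" using edge_familyD[OF y e] by simp
  also have "\<dots> = y b" using "3.IH"(2)[OF W _ _ a'(1)] "3.prems"(3) a'(2) by simp
  finally show ?case .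
qed

text \<open>The walk is an arbitrary choice. On the based inscribed space the result does not depend
  on it, because two walks with the same ends become closed by a common return walk; on other
  vectors it may.\<close>

definition path_map :: "'a::euclidean_space set \<Rightarrow> 'a \<Rightarrow> 'a \<Rightarrow> 'a \<Rightarrow> 'a" where
  "path_map P v w = walk_map (SOME W. is_walk (normal_fan P) W \<and> hd W = normal_cone P {v} \<and> last W = normal_cone P {w})"

lemma walk_exists:
  fixes P :: "'a::euclidean_space set"
  assumes P: "polytope P" and v: "v \<in> vertices P" and w: "w \<in> vertices P"
  shows "\<exists>W. is_walk (normal_fan P) W \<and> hd W = normal_cone P {w} \<and> last W = normal_cone P {v}"
proof -
  obtain c where c: "c \<in> strict_cone P v" using strict_cone_nonempty[OF P v] by blast
  show ?thesis
  proof (rule improving_path_induct[OF P v c w, of "\<lambda>w. \<exists>W. is_walk (normal_fan P) W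
      \<and> hd W = normal_cone P {w} \<and> last W = normal_cone P {v}"])
    show "\<exists>W. is_walk (normal_fan P) W \<and> hd W = normal_cone P {v} \<and> last W = normal_cone P {v}"
      using v regions_normal_fan[OF P] by (intro exI[of _ "[normal_cone P {v}]"]) (simp add: is_walk_singleton)
  next
    fix a b assume e: "is_edge P a b"
      and "\<exists>W. is_walk (normal_fan P) W \<and> hd W = normal_cone P {b} \<and> last W = normal_cone P {v}"
    then obtain W where W: "is_walk (normal_fan P) W" "hd W = normal_cone P {b}" "last W = normal_cone P {v}"
      by blast
    obtain R W' where RW: "W = R # W'" using W(1) by (cases W) (auto simp: is_walk_def)
    have "adjacent (normal_fan P) (normal_cone P {a}) R"
      using adjacent_normal_fan_iff[OF P is_edge_vertices[OF e]] e W(2) RW by simp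
    then show "\<exists>W. is_walk (normal_fan P) W \<and> hd W = normal_cone P {a} \<and> last W = normal_cone P {v}"
      using W RW by (intro exI[of _ "normal_cone P {a} # W"]) (simp add: is_walk_Cons_Cons)
  qed
qed

lemma path_map_walk:
  assumes "polytope P" "v \<in> vertices P" "w \<in> vertices P"
  shows "\<exists>W. is_walk (normal_fan P) W \<and> hd W = normal_cone P {v} \<and> last W = normal_cone P {w}
    \<and> path_map P v w = walk_map W"
  unfolding path_map_def using someI_ex[OF walk_exists[OF assms(1,3,2)]] by blast

lemma orthogonal_transformation_path_map: "orthogonal_transformation (path_map P v w)"
  unfolding path_map_def by (rule orthogonal_transformation_walk_map)

lemma path_map_edge_family:
  assumes P: "polytope P" and "edge_family P y" "v \<in> vertices P" "w \<in> vertices P"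
  shows "path_map P v w (y v) = y w"
  using path_map_walk[OF assms(1,3,4)] walk_map_edge_family[OF assms(1,2) _ _ _ assms(3,4)] by metis

lemma edge_family_in_InSpc:
  assumes P: "polytope P" and "edge_family P y" "v \<in> vertices P"
  shows "y v \<in> InSpc (normal_fan P) (normal_cone P {v})"
  unfolding InSpc_def using walk_map_edge_family[OF assms(1,2) _ _ _ assms(3,3)] by blast

lemma path_map_self:
  assumes P: "polytope P" and "v \<in> vertices P"
    and "y \<in> InSpc (normal_fan P) (normal_cone P {v})"
  shows "path_map P v v y = y"
  using path_map_walk[OF assms(1,2,2)] assms(3) unfolding InSpc_def by auto

lemma InSpc_closed_walk:
  assumes "y \<in> InSpc \<F> R" "is_walk \<F> W" "hd W = R" "last W = R"
  shows "walk_map W y = y"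
  using assms unfolding InSpc_def by blast

text \<open>The walk to v followed by the step to w, and the chosen walk to w, are both closed up by
  the same walk back to \<open>v0\<close>. Both closed walks fix \<open>y\<close>, and the map of
  the return walk is injective.\<close>

lemma edge_family_path_map:
  fixes P :: "'a::euclidean_space set"
  assumes P: "polytope P" and v0: "v0 \<in> vertices P"
    and y: "y \<in> InSpc (normal_fan P) (normal_cone P {v0})"
  shows "edge_family P (\<lambda>v. path_map P v0 v y)"
  unfolding edge_family_def
proof (intro allI impI)
  fix v w assume e: "is_edge P v w"
  have v: "v \<in> vertices P" and w: "w \<in> vertices P" using is_edge_vertices[OF e] by auto
  obtain W1 where W1: "is_walk (normal_fan P) W1" "hd W1 = normal_cone P {v0}"
      "last W1 = normal_cone P {v}" "path_map P v0 v = walk_map W1"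
    using path_map_walk[OF P v0 v] by blast
  obtain W2 where W2: "is_walk (normal_fan P) W2" "hd W2 = normal_cone P {v0}"
      "last W2 = normal_cone P {w}" "path_map P v0 w = walk_map W2"
    using path_map_walk[OF P v0 w] by blast
  obtain W3 where "is_walk (normal_fan P) W3" "hd W3 = normal_cone P {w}" "last W3 = normal_cone P {v0}"
    using walk_exists[OF P v0 w] by blast
  then obtain W where W: "is_walk (normal_fan P) (normal_cone P {w} # W)"
      "last (normal_cone P {w} # W) = normal_cone P {v0}"
    by (metis is_walk_def list.collapse)
  let ?r = "walk_map (normal_cone P {w} # W)"
  have adj: "adjacent (normal_fan P) (normal_cone P {v}) (normal_cone P {w})"
    using adjacent_normal_fan_iff[OF P v w] e by simp
  have "is_walk (normal_fan P) (last W1 # normal_cone P {w} # W)"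
    using W adj W1(3) by (simp add: is_walk_Cons_Cons)
  note A = is_walk_append[OF W1(1) this]
  have "walk_map (W1 @ normal_cone P {w} # W) y = y"
    by (rule InSpc_closed_walk[OF y]) (use A W W1(2) in simp_all)
  then have "walk_map (last W1 # normal_cone P {w} # W) (walk_map W1 y) = y" using A by simp
  moreover have "refl_adj (normal_cone P {w}) (normal_cone P {v}) = reflect (w - v)"
    using refl_adj_normal_cones[OF P, of w v] e by (simp add: is_edge_sym reflect_minus_commute)
  ultimately have 1: "?r (reflect (w - v) (walk_map W1 y)) = y" using W1(3) by simp
  have "is_walk (normal_fan P) (last W2 # W)" using W W2(3) by simp
  note A = is_walk_append[OF W2(1) this]
  have "walk_map (W2 @ W) y = y"
    by (rule InSpc_closed_walk[OF y]) (use A W W2(2,3) in simp_all)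
  then have 2: "?r (walk_map W2 y) = y" using A W2(3) by simp
  have "inj ?r" using orthogonal_transformation_inj[OF orthogonal_transformation_walk_map] .
  then show "path_map P v0 w y = reflect (w - v) (path_map P v0 v y)"
    using 1 2 W1(4) W2(4) by (metis injD)
qed

lemma subspace_InSpc: "subspace (InSpc \<F> R)"
proof -
  have "linear (walk_map W)" for W :: "'a set list"
    using orthogonal_transformation_walk_map orthogonal_transformation_linear by blast
  then show ?thesis
    unfolding subspace_def InSpc_def by (auto simp: linear_0 linear_add linear_cmul)
qed

section \<open>Inscribed realizations versus edge families\<close>

lemma inner_le_on_convex_hull:
  fixes c :: "'a::euclidean_space"
  assumes "\<And>x. x \<in> S \<Longrightarrow> c \<bullet> x \<le> t" and "x \<in> convex hull S"
  shows "c \<bullet> x \<le> t"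
proof -
  have "convex hull S \<subseteq> {x. c \<bullet> x \<le> t}"
    by (rule hull_minimal) (use assms(1) convex_halfspace_le in auto)
  then show ?thesis using assms(2) by blast
qed

text \<open>If a functional c attains its maximum at v and g does so uniquely, then c + t g attains its
  maximum uniquely at v for every t > 0, so the case of unique maxima passes to the limit.\<close>

lemma normal_cone_inner_mono:
  fixes P :: "'a::euclidean_space set"
  assumes P: "polytope P" and v: "v \<in> vertices P" and w: "w \<in> vertices P"
    and y: "\<And>a b. is_edge P a b \<Longrightarrow> \<exists>k>0. y b - y a = k *\<^sub>R (b - a)"
    and c: "c \<in> normal_cone P {v}"
  shows "c \<bullet> y w \<le> c \<bullet> y v"
proof (rule ccontr)
  assume "\<not> ?thesis"
  then have D: "c \<bullet> y w - c \<bullet> y v > 0" (is "?D > 0") by simp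
  obtain g where g: "g \<in> strict_cone P v" using strict_cone_nonempty[OF P v] by blast
  \<comment> \<open>Chosen so that the perturbation by \<open>g\<close> accounts for at most half of
    the assumed gap; the \<open>+ 1\<close> keeps the denominator positive.\<close>
  define t where "t = ?D / (2 * (\<bar>g \<bullet> (y v - y w)\<bar> + 1))"
  have t: "t > 0" using D by (simp add: t_def add_nonneg_pos)
  have "c + t *\<^sub>R g \<in> strict_cone P v"
    unfolding strict_cone_def
  proof (intro CollectI ballI)
    fix x assume x: "x \<in> vertices P - {v}"
    then have "c \<bullet> x \<le> c \<bullet> v" using c mem_normal_cone_vertex[OF P v] by blast
    moreover have "t * (g \<bullet> x) < t * (g \<bullet> v)" using g x t by (simp add: strict_cone_def)
    ultimately show "(c + t *\<^sub>R g) \<bullet> x < (c + t *\<^sub>R g) \<bullet> v" by (simp add: inner_left_distrib)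
  qed
  then have "(c + t *\<^sub>R g) \<bullet> y w \<le> (c + t *\<^sub>R g) \<bullet> y v"
  proof (rule improving_path_induct[OF P v _ w, where Q = "\<lambda>w. (c + t *\<^sub>R g) \<bullet> y w \<le> (c + t *\<^sub>R g) \<bullet> y v"])
    fix a b assume e: "is_edge P a b" "(c + t *\<^sub>R g) \<bullet> a < (c + t *\<^sub>R g) \<bullet> b"
      and b: "(c + t *\<^sub>R g) \<bullet> y b \<le> (c + t *\<^sub>R g) \<bullet> y v"
    obtain k where k: "k > 0" "y b - y a = k *\<^sub>R (b - a)" using y[OF e(1)] by blast
    have "(c + t *\<^sub>R g) \<bullet> (y b - y a) \<ge> 0"
      using e(2) k(1) by (simp add: k(2) inner_diff_right[of _ b a])
    then show "(c + t *\<^sub>R g) \<bullet> y a \<le> (c + t *\<^sub>R g) \<bullet> y v" using b by (simp add: inner_diff_right)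
  qed simp
  then have "?D \<le> t * (g \<bullet> (y v - y w))" by (simp add: inner_left_distrib inner_diff_right algebra_simps)
  also have "\<dots> \<le> t * (\<bar>g \<bullet> (y v - y w)\<bar> + 1)" using t by (intro mult_left_mono) auto
  also have "\<dots> = ?D / 2" by (simp add: t_def field_simps)
  finally show False using D by simp
qed

text \<open>Positive factors preserve the sign of every functional on every edge, and by the
  improving-edge criterion these signs decide which vertices are maximal. So the normal cones of the
  vertices survive, hence the regions, hence the fan.\<close>

lemma edge_parallel_realization:
  fixes P :: "'a::euclidean_space set"
  assumes P: "polytope P" "P \<noteq> {}"
    and y: "\<And>a b. is_edge P a b \<Longrightarrow> \<exists>k>0. y b - y a = k *\<^sub>R (b - a)"
  defines "Q \<equiv> convex hull (y ` vertices P)"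
  shows "polytope Q" and "vertices Q \<subseteq> y ` vertices P" and "normal_fan Q = normal_fan P"
    and "\<And>v. v \<in> vertices P \<Longrightarrow> normal_cone Q {y v} = normal_cone P {v}"
proof -
  show pQ: "polytope Q" unfolding Q_def using finite_vertices[OF P(1)] by (intro polytope_convex_hull) simp
  show vQ: "vertices Q \<subseteq> y ` vertices P"
    unfolding Q_def vertices_def using extreme_point_of_convex_hull by blast
  have yQ: "y v \<in> Q" if "v \<in> vertices P" for v unfolding Q_def using that by (intro hull_inc) simp
  show cone: "normal_cone Q {y v} = normal_cone P {v}" if v: "v \<in> vertices P" for v
  proof (intro equalityI subsetI)
    fix c assume c: "c \<in> normal_cone P {v}"
    have "c \<bullet> x \<le> c \<bullet> y v" if "x \<in> Q" for x
    proof (rule inner_le_on_convex_hull)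
      show "x \<in> convex hull (y ` vertices P)" using that by (simp add: Q_def)
    qed (use normal_cone_inner_mono[OF P(1) v _ y c] in blast)
    then show "c \<in> normal_cone Q {y v}" by (simp add: normal_cone_def)
  next
    fix c assume c: "c \<in> normal_cone Q {y v}"
    show "c \<in> normal_cone P {v}"
    proof (rule ccontr)
      assume "c \<notin> normal_cone P {v}"
      then obtain x where x: "x \<in> P" "c \<bullet> v < c \<bullet> x" by (auto simp: normal_cone_def not_le)
      obtain w where w: "is_edge P v w" "c \<bullet> v < c \<bullet> w" using improving_edge[OF P(1) v x] by blast
      obtain k where k: "k > 0" "y w - y v = k *\<^sub>R (w - v)" using y[OF w(1)] by blast
      have "c \<bullet> (y w - y v) > 0" using w(2) k(1) by (simp add: k(2) inner_diff_right[of _ w v])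
      moreover have "c \<bullet> y w \<le> c \<bullet> y v"
        using c yQ[OF is_edge_vertices(2)[OF w(1)]] by (simp add: normal_cone_def)
      ultimately show False by (simp add: inner_diff_right)
    qed
  qed
  have Q0: "Q \<noteq> {}" using vertices_nonempty[OF P] by (simp add: Q_def)
  \<comment> \<open>A functional strictly maximised at v attains its maximum over Q at some vertex
    \<open>y w\<close>; equality of the cones forces w = v.\<close>
  have "y v \<in> vertices Q" if v: "v \<in> vertices P" for v
  proof -
    obtain c where c: "c \<in> strict_cone P v" using strict_cone_nonempty[OF P(1) v] by blast
    let ?F = "{x \<in> Q. \<forall>z\<in>Q. c \<bullet> z \<le> c \<bullet> x}"
    have F: "?F face_of Q" "?F \<noteq> {}" using max_face[OF pQ Q0, of c] by auto
    obtain x where x: "x \<in> vertices ?F"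
      using vertices_nonempty[OF face_of_polytope_polytope[OF pQ F(1)] F(2)] by blast
    then have "x \<in> vertices Q" "x \<in> ?F" using vertices_of_face[OF F(1)] vertices_subset by blast+
    then obtain w where w: "w \<in> vertices P" "x = y w" using vQ by blast
    have "c \<in> normal_cone Q {x}" using \<open>x \<in> ?F\<close> by (simp add: normal_cone_def)
    then have "w = v" using strict_cone_unique[OF P(1) v w(1) c] cone[OF w(1)] w(2) by simp
    then show ?thesis using \<open>x \<in> vertices Q\<close> w(2) by simp
  qed
  then have "vertices Q = y ` vertices P" using vQ by blast
  then have "regions (normal_fan Q) = regions (normal_fan P)"
    using cone by (simp add: regions_normal_fan[OF pQ] regions_normal_fan[OF P(1)] image_image)
  then show "normal_fan Q = normal_fan P" by (intro normal_fan_eqI P pQ Q0)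
qed

lemma support_fun_eq:
  assumes "x \<in> Q" "u \<in> normal_cone Q {x}"
  shows "support_fun Q u = u \<bullet> x"
  unfolding support_fun_def by (rule cSup_eq_maximum) (use assms in \<open>auto simp: normal_cone_def\<close>)

text \<open>\<open>z\<close> is the centre of the sphere and \<open>y v\<close> the vertex of Q with
  the same normal cone as v, relative to \<open>z\<close>. The wall between two regions fixes the
  direction of the edge of Q, equal distances to \<open>z\<close> turn the edge into a reflection,
  and the normal cones decide its orientation.\<close>

lemma inscribed_realization_edge_family:
  fixes P :: "'a::euclidean_space set"
  assumes P: "polytope P" "P \<noteq> {}" and Q: "Q \<in> inscribed_realizations P"
  shows "\<exists>z y. edge_family P y \<and> (\<forall>v w. is_edge P v w \<longrightarrow> y v \<bullet> (w - v) < 0) \<and>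
    (\<forall>v\<in>vertices P. \<forall>u\<in>normal_cone P {v}. support_fun Q u = u \<bullet> (z + y v))"
proof -
  have pQ: "polytope Q" and fan: "normal_fan Q = normal_fan P"
    using Q by (auto simp: inscribed_realizations_def inscribed_def)
  obtain z r where zr: "\<And>v. v \<in> vertices Q \<Longrightarrow> dist z v = r"
    using Q by (auto simp: inscribed_realizations_def inscribed_def)
  have "(\<lambda>v. normal_cone Q {v}) ` vertices Q = (\<lambda>v. normal_cone P {v}) ` vertices P"
    using regions_normal_fan[OF pQ] regions_normal_fan[OF P(1)] fan by simp
  then have "\<forall>v\<in>vertices P. \<exists>x\<in>vertices Q. normal_cone Q {x} = normal_cone P {v}"
    by (metis (no_types, lifting) image_iff)
  then obtain q where q: "\<And>v. v \<in> vertices P \<Longrightarrow> q v \<in> vertices Q"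
      and cone: "\<And>v. v \<in> vertices P \<Longrightarrow> normal_cone Q {q v} = normal_cone P {v}"
    by metis
  define y where "y = (\<lambda>v. q v - z)"
  have key: "y w = reflect (w - v) (y v) \<and> y v \<bullet> (w - v) < 0" if e: "is_edge P v w" for v w
  proof -
    have v: "v \<in> vertices P" and w: "w \<in> vertices P" using is_edge_vertices[OF e] by auto
    have vw: "v \<noteq> w" using e by (simp add: is_edge_def)
    have qvQ: "q v \<in> Q" and qwQ: "q w \<in> Q" using q v w vertices_subset by blast+
    let ?K = "normal_cone P {v} \<inter> normal_cone P {w}"
    have span: "span ?K = {c. (w - v) \<bullet> c = 0}"
      using v w vertices_subset vw by (intro span_normal_cones_inter aff_dim_normal_cones_inter_edge[OF P(1) e]) auto
    have "?K \<subseteq> {c. (q w - q v) \<bullet> c = 0}"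
      using normal_cones_inter_subset[OF qvQ qwQ] unfolding cone[OF v] cone[OF w] .
    then have "span ?K \<subseteq> {c. (q w - q v) \<bullet> c = 0}" by (intro span_minimal subspace_hyperplane)
    then have par: "q w - q v = (((q w - q v) \<bullet> (w - v)) / ((w - v) \<bullet> (w - v))) *\<^sub>R (w - v)"
      using span by (intro parallel_of_orthogonal_hyperplane) blast
    define k where "k = ((q w - q v) \<bullet> (w - v)) / ((w - v) \<bullet> (w - v))"
    have "q w - q v = k *\<^sub>R (w - v)" using par unfolding k_def .
    then have yw: "y w = y v + k *\<^sub>R (w - v)" by (simp add: y_def algebra_simps)
    have "q v \<noteq> q w" using cone[OF v] cone[OF w] normal_cone_vertex_inj[OF P(1) v w] vw by auto
    then have k0: "k \<noteq> 0" using yw by (auto simp: y_def)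
    have pos: "(w - v) \<bullet> (w - v) > 0" using vw by simp
    have "norm (y v) = norm (y w)"
      using zr[OF q[OF v]] zr[OF q[OF w]] by (simp add: y_def dist_norm norm_minus_commute)
    then have "y v \<bullet> y v = y w \<bullet> y w" by (simp add: dot_square_norm)
    \<comment> \<open>Equal norms are a quadratic condition on \<open>k\<close>; the root
      \<open>k = 0\<close> would identify two vertices of Q with different normal cones.\<close>
    then have "k * (2 * (y v \<bullet> (w - v)) + k * ((w - v) \<bullet> (w - v))) = 0"
      unfolding yw by (simp add: inner_left_distrib inner_right_distrib inner_commute algebra_simps)
    then have k: "2 * (y v \<bullet> (w - v)) = - k * ((w - v) \<bullet> (w - v))" using k0 by simp
    then have "y w = reflect (w - v) (y v)"
      using pos by (simp add: yw reflect_def k)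
    moreover have "k \<ge> 0"
    proof -
      obtain c where c: "c \<in> strict_cone P w" using strict_cone_nonempty[OF P(1) w] by blast
      then have "c \<in> normal_cone Q {q w}" using strict_cone_subset[OF P(1) w] cone[OF w] by blast
      then have "c \<bullet> (q w - q v) \<ge> 0" using qvQ by (simp add: normal_cone_def inner_diff_right)
      moreover have "c \<bullet> (q w - q v) = k * (c \<bullet> (w - v))" using par by (metis k_def inner_scaleR_right)
      moreover have "c \<bullet> (w - v) > 0" using c v vw by (simp add: strict_cone_def inner_diff_right)
      ultimately show ?thesis by (simp add: zero_le_mult_iff)
    qed
    moreover have "k * ((w - v) \<bullet> (w - v)) > 0" using \<open>k \<ge> 0\<close> k0 pos by simp
    ultimately show ?thesis using k by simp
  qed
  have "support_fun Q u = u \<bullet> (z + y v)" if "v \<in> vertices P" "u \<in> normal_cone P {v}" for u v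
    using support_fun_eq[of "q v" Q u] q[OF that(1)] vertices_subset cone[OF that(1)] that(2)
    by (auto simp: y_def)
  then show ?thesis using key unfolding edge_family_def by blast
qed

text \<open>Reflections preserve norms, so the points lie on a sphere about \<open>z\<close>; the
  sign condition makes each reflection step a positive multiple of the edge, so the fan is
  kept.\<close>

lemma edge_family_inscribed_realization:
  fixes P :: "'a::euclidean_space set"
  assumes P: "polytope P" "P \<noteq> {}" and y: "edge_family P y"
    and neg: "\<And>v w. is_edge P v w \<Longrightarrow> y v \<bullet> (w - v) < 0"
  shows "\<exists>Q\<in>inscribed_realizations P.
    \<forall>v\<in>vertices P. \<forall>u\<in>normal_cone P {v}. support_fun Q u = u \<bullet> (z + y v)"
proof -
  define x where "x = (\<lambda>v. z + y v)"
  have x: "\<exists>k>0. x w - x v = k *\<^sub>R (w - v)" if e: "is_edge P v w" for v w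
  proof (intro exI conjI)
    show "- (2 * (y v \<bullet> (w - v)) / ((w - v) \<bullet> (w - v))) > 0"
      using neg[OF e] e by (auto simp: is_edge_def divide_less_0_iff)
    show "x w - x v = - (2 * (y v \<bullet> (w - v)) / ((w - v) \<bullet> (w - v))) *\<^sub>R (w - v)"
      using edge_familyD[OF y e] by (simp add: x_def reflect_def)
  qed
  define Q where "Q = convex hull (x ` vertices P)"
  have Q: "polytope Q" "vertices Q \<subseteq> x ` vertices P" "normal_fan Q = normal_fan P"
    unfolding Q_def by (intro edge_parallel_realization[OF P] x; assumption)+
  have cone: "normal_cone Q {x v} = normal_cone P {v}" if "v \<in> vertices P" for v
    unfolding Q_def by (intro edge_parallel_realization(4)[OF P] x that)
  obtain v0 where v0: "v0 \<in> vertices P" using vertices_nonempty[OF P] by blast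
  have "dist z p = norm (y v0)" if "p \<in> vertices Q" for p
    using that Q(2) norm_edge_family[OF P(1) y v0] by (auto simp: x_def dist_norm)
  then have "Q \<in> inscribed_realizations P"
    using Q(1,3) unfolding inscribed_realizations_def inscribed_def by blast
  moreover have "support_fun Q u = u \<bullet> (z + y v)" if "v \<in> vertices P" "u \<in> normal_cone P {v}" for u v
  proof -
    have "x v \<in> Q" unfolding Q_def using that(1) by (intro hull_inc) simp
    then show ?thesis using support_fun_eq[of "x v" Q u] cone[OF that(1)] that(2) by (simp add: x_def)
  qed
  ultimately show ?thesis by blast
qed

section \<open>The dimension of the inscribed cone\<close>

lemma vector_space_fscale: "vector_space fscale"
  by unfold_locales (auto simp: fscale_def fun_eq_iff algebra_simps)

lemma fdim_eqI:
  assumes "S \<subseteq> T" "T \<subseteq> module.span fscale S"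
  shows "fdim S = fdim T"
proof -
  interpret vector_space fscale by (rule vector_space_fscale)
  have "span S = span T" using assms span_mono span_minimal subspace_span by blast
  then show ?thesis unfolding fdim_def by (rule span_eq_dim)
qed

text \<open>\<open>fscale\<close> is not the scalar multiplication of a type class, so a basis of
  \<open>S\<close> is carried over inside the locale for pairs of vector spaces.\<close>

lemma fdim_linear_image:
  fixes f :: "'b::euclidean_space \<Rightarrow> 'a \<Rightarrow> real"
  assumes add: "\<And>x y. f (x + y) = f x + f y" and scale: "\<And>c x. f (c *\<^sub>R x) = fscale c (f x)"
    and S: "subspace S" and inj: "\<And>x. x \<in> S \<Longrightarrow> f x = 0 \<Longrightarrow> x = 0"
  shows "fdim (f ` S) = dim S"
proof -
  interpret fs: vector_space fscale by (rule vector_space_fscale)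
  interpret pair: vector_space_pair "scaleR :: real \<Rightarrow> 'b \<Rightarrow> 'b" fscale by unfold_locales
  have lin: "Vector_Spaces.linear scaleR fscale f"
    by unfold_locales (auto simp: add scale)
  obtain B where B: "B \<subseteq> S" "independent B" "S \<subseteq> span B" "card B = dim S"
    using basis_exists by blast
  have SB: "span B = S" using span_subspace[OF B(1,3) S] .
  have injS: "inj_on f S"
  proof (rule inj_onI)
    fix x y assume xy: "x \<in> S" "y \<in> S" "f x = f y"
    have "f (x - y) + f y = f x" using add[of "x - y" y] by simp
    then have "f (x - y) = 0" using xy(3) by simp
    then show "x = y" using inj[OF subspace_diff[OF S xy(1,2)]] by simp
  qed
  have "fs.independent (f ` B)"
    using pair.linear_independent_injective_image[OF lin, of B] B(2) injS SB
    by (simp add: dependent_raw_def span_raw_def)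
  moreover have "fs.span (f ` B) = f ` S"
    using pair.linear_span_image[OF lin, of B] SB by (simp add: span_raw_def)
  moreover have "f ` B \<subseteq> f ` S" using B(1) by blast
  ultimately have "fs.dim (f ` S) = card (f ` B)"
    using fs.basis_card_eq_dim[of "f ` B" "f ` S"] by simp
  also have "\<dots> = card B" using inj_on_subset[OF injS B(1)] by (rule card_image)
  finally show ?thesis using B(4) by (simp add: fdim_def)
qed

lemma normal_cones_cover:
  fixes P :: "'a::euclidean_space set"
  assumes P: "polytope P" "P \<noteq> {}"
  shows "\<exists>v\<in>vertices P. u \<in> normal_cone P {v}"
proof -
  let ?F = "{x \<in> P. \<forall>y\<in>P. u \<bullet> y \<le> u \<bullet> x}"
  have F: "?F face_of P" "?F \<noteq> {}" using max_face[OF P, of u] by auto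
  obtain v where v: "v \<in> vertices ?F"
    using vertices_nonempty[OF face_of_polytope_polytope[OF P(1) F(1)] F(2)] by blast
  then have "v \<in> vertices P" "v \<in> ?F" using vertices_of_face[OF F(1)] vertices_subset by blast+
  then show ?thesis by (intro bexI[of _ v]) (auto simp: normal_cone_def)
qed

lemma reflect_fixed_iff: "n \<noteq> 0 \<Longrightarrow> reflect n x = x \<longleftrightarrow> x \<bullet> n = 0"
  by (auto simp: reflect_def)

text \<open>If \<open>c\<close> is not constant on P, then \<open>c\<close> or \<open>- c\<close>
  has an improving edge at a vertex; if it is constant and nonzero, P lies in a hyperplane.\<close>

lemma functional_constant_on_edges:
  fixes P :: "'a::euclidean_space set"
  assumes P: "polytope P" "aff_dim P = int DIM('a)"
    and c: "\<And>v w. is_edge P v w \<Longrightarrow> c \<bullet> (w - v) = 0"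
  shows "c = 0"
proof (rule ccontr)
  assume "c \<noteq> 0"
  have "P \<noteq> {}" using P(2) by auto
  then obtain v where v: "v \<in> vertices P" using vertices_nonempty[OF P(1)] by blast
  have "c \<bullet> x = c \<bullet> v" if x: "x \<in> P" for x
  proof (rule ccontr)
    assume "c \<bullet> x \<noteq> c \<bullet> v"
    then consider "c \<bullet> v < c \<bullet> x" | "(- c) \<bullet> v < (- c) \<bullet> x" by force
    then show False
    proof cases
      case 1
      then obtain w where "is_edge P v w" "c \<bullet> v < c \<bullet> w" using improving_edge[OF P(1) v x] by blast
      then show False using c[of v w] by (simp add: inner_diff_right)
    next
      case 2
      then obtain w where "is_edge P v w" "(- c) \<bullet> v < (- c) \<bullet> w" using improving_edge[OF P(1) v x] by blast
      then show False using c[of v w] by (simp add: inner_diff_right)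
    qed
  qed
  then have "P \<subseteq> {x. c \<bullet> x = c \<bullet> v}" by blast
  then have "aff_dim P \<le> aff_dim {x. c \<bullet> x = c \<bullet> v}" by (rule aff_dim_subset)
  then show False using P(2) \<open>c \<noteq> 0\<close> by (simp add: aff_dim_hyperplane)
qed

lemma linear_path_map: "linear (path_map P v w)"
  using orthogonal_transformation_path_map orthogonal_transformation_linear by blast

text \<open>The linear map \<open>h\<close> sends a centre and a base value to the function whose
  linear pieces are the points of the corresponding family. It is injective, translations are the
  image of the pairs with base value 0, and realizations together with translations span the whole
  image.\<close>

lemma InCone_dim_eq_dim_InSpc:
  fixes P :: "'a::euclidean_space set"
  assumes P: "polytope P" and full: "aff_dim P = int DIM('a)"
    and ex: "inscribed_realizations P \<noteq> {}" and v0: "v0 \<in> vertices P"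
  shows "InCone_dim P = dim (InSpc (normal_fan P) (normal_cone P {v0}))"
proof -
  have P0: "P \<noteq> {}" using full by auto
  let ?I = "InSpc (normal_fan P) (normal_cone P {v0})"
  let ?H = "support_fun ` inscribed_realizations P"
  let ?T = "translation_funs :: ('a \<Rightarrow> real) set"
  interpret fs: vector_space fscale by (rule vector_space_fscale)
  define g where "g = path_map P v0"
  have glin: "linear (g v)" for v unfolding g_def by (rule linear_path_map)
  \<comment> \<open>A vertex maximising \<open>u\<close>. On walls there are several; fixing one
    independently of \<open>p\<close> is what makes \<open>h p\<close> linear in
    \<open>p\<close>.\<close>
  define r where "r u = (SOME v. v \<in> vertices P \<and> u \<in> normal_cone P {v})" for u
  have r: "r u \<in> vertices P" "u \<in> normal_cone P {r u}" for u
    using someI_ex[of "\<lambda>v. v \<in> vertices P \<and> u \<in> normal_cone P {v}"] normal_cones_cover[OF P P0, of u]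
    unfolding r_def by blast+
  define h where "h p u = u \<bullet> (fst p + g (r u) (snd p))" for p u
  have h_add: "h (p + q) = h p + h q" for p q
    by (simp add: h_def fun_eq_iff linear_add[OF glin] inner_right_distrib)
  have h_scale: "h (c *\<^sub>R p) = fscale c (h p)" for c p
    by (simp add: h_def fscale_def fun_eq_iff linear_cmul[OF glin] inner_right_distrib distrib_left)
  define S where "S = (UNIV :: 'a set) \<times> ?I"
  have S: "subspace S" unfolding S_def by (intro subspace_Times subspace_UNIV subspace_InSpc)
  \<comment> \<open>If \<open>h p\<close> vanishes, testing on the open cones shows that the family
    is constantly \<open>- c\<close>. A vector fixed by all edge reflections is orthogonal to all
    edges, hence 0.\<close>
  have inj: "p = 0" if p: "p \<in> S" "h p = 0" for p
  proof -
    obtain c y where cy: "p = (c, y)" "y \<in> ?I" using p(1) by (auto simp: S_def)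
    have gv: "g v y = - c" if v: "v \<in> vertices P" for v
    proof -
      have "u \<bullet> (g v y) = u \<bullet> (- c)" if u: "u \<in> strict_cone P v" for u
      proof -
        have "r u = v" using strict_cone_unique[OF P v r(1) u r(2)] .
        then have "u \<bullet> (c + g v y) = 0" using fun_cong[OF p(2), of u] by (simp add: h_def cy(1))
        then show ?thesis by (simp add: inner_right_distrib)
      qed
      then show ?thesis
        by (rule eq_of_inner_eq_on_open[OF open_strict_cone[OF P] strict_cone_nonempty[OF P v]])
    qed
    have "c = 0"
    proof (rule functional_constant_on_edges[OF P full])
      fix v w assume e: "is_edge P v w"
      have "g w y = reflect (w - v) (g v y)"
        using edge_familyD[OF edge_family_path_map[OF P v0 cy(2)] e] by (simp add: g_def)
      then have "reflect (w - v) (- c) = - c" using gv is_edge_vertices[OF e] by simp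
      then show "c \<bullet> (w - v) = 0" using reflect_fixed_iff[of "w - v" "- c"] e by (auto simp: is_edge_def)
    qed
    moreover have "y = - c" using gv[OF v0] path_map_self[OF P v0 cy(2)] by (simp add: g_def)
    ultimately show ?thesis by (simp add: cy(1) zero_prod_def)
  qed
  have H_sub: "?H \<subseteq> h ` S"
  proof
    fix f assume "f \<in> ?H"
    then obtain Q where Q: "Q \<in> inscribed_realizations P" "f = support_fun Q" by blast
    obtain z y where y: "edge_family P y"
        "\<forall>v\<in>vertices P. \<forall>u\<in>normal_cone P {v}. support_fun Q u = u \<bullet> (z + y v)"
      using inscribed_realization_edge_family[OF P P0 Q(1)] by blast
    have "f u = h (z, y v0) u" for u
      using y(2) r path_map_edge_family[OF P y(1) v0 r(1)] by (simp add: Q(2) h_def g_def)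
    moreover have "(z, y v0) \<in> S" using edge_family_in_InSpc[OF P y(1) v0] by (simp add: S_def)
    ultimately show "f \<in> h ` S" by blast
  qed
  have T_eq: "?T = h ` (UNIV \<times> {0})"
    unfolding translation_funs_def by (auto simp: h_def linear_0[OF glin] fun_eq_iff image_iff)
  have "0 \<in> ?I" using subspace_0[OF subspace_InSpc] .
  then have T_sub: "?T \<subseteq> h ` S" unfolding T_eq S_def by blast
  obtain Q0 where "Q0 \<in> inscribed_realizations P" using ex by blast
  then obtain x where x: "edge_family P x" "\<And>v w. is_edge P v w \<Longrightarrow> x v \<bullet> (w - v) < 0"
    using inscribed_realization_edge_family[OF P P0] by blast
  \<comment> \<open>The orientation conditions, one open half-space per edge. Within the based
    inscribed space they single out the base values of inscribed realizations.\<close>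
  define U where "U = {y. \<forall>e\<in>{(v, w). is_edge P v w}. g (fst e) y \<bullet> (snd e - fst e) < 0}"
  have "{(v, w). is_edge P v w} \<subseteq> vertices P \<times> vertices P" using is_edge_vertices by auto
  then have fin: "finite {(v, w). is_edge P v w}"
    using finite_vertices[OF P] finite_subset by blast
  have "open {y. g (fst e) y \<bullet> (snd e - fst e) < 0}" for e
    by (intro open_Collect_less continuous_intros linear_continuous_on_compose[OF _ glin])
  moreover have "U = (\<Inter>e\<in>{(v, w). is_edge P v w}. {y. g (fst e) y \<bullet> (snd e - fst e) < 0})"
    unfolding U_def by blast
  ultimately have oU: "open U" using fin by (simp add: open_INT)
  have x0: "x v0 \<in> ?I" by (rule edge_family_in_InSpc[OF P x(1) v0])
  have "g v (x v0) \<bullet> (w - v) < 0" if e: "is_edge P v w" for v w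
    using x(2)[OF e] path_map_edge_family[OF P x(1) v0 is_edge_vertices(1)[OF e]] by (simp add: g_def)
  then have x0U: "x v0 \<in> U" unfolding U_def by auto
  have in_H: "h (z, y) \<in> ?H" if y: "y \<in> ?I" "y \<in> U" for z y
  proof -
    have neg: "g v y \<bullet> (w - v) < 0" if "is_edge P v w" for v w using y(2) that unfolding U_def by auto
    have "edge_family P (\<lambda>v. g v y)" unfolding g_def by (rule edge_family_path_map[OF P v0 y(1)])
    then obtain Q where Q: "Q \<in> inscribed_realizations P"
        "\<forall>v\<in>vertices P. \<forall>u\<in>normal_cone P {v}. support_fun Q u = u \<bullet> (z + g v y)"
      using edge_family_inscribed_realization[OF P P0, of "\<lambda>v. g v y" z] neg by blast
    have "h (z, y) u = support_fun Q u" for u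
      using Q(2)[rule_format, OF r(1)[of u] r(2)[of u]] by (simp add: h_def)
    then have "h (z, y) = support_fun Q" by blast
    then show ?thesis using Q(1) by blast
  qed
  have S_sub: "h ` S \<subseteq> fs.span (?H \<union> ?T)"
  proof
    fix f assume "f \<in> h ` S"
    then obtain c y where cy: "f = h (c, y)" "y \<in> ?I" by (auto simp: S_def)
    \<comment> \<open>For small t > 0 the vector \<open>x v0 + t *\<^sub>R y\<close> is still
      admissible, so \<open>y\<close> is a scaled difference of two admissible base values.\<close>
    have "((\<lambda>t. x v0 + t *\<^sub>R y) \<longlongrightarrow> x v0 + 0 *\<^sub>R y) (at_right 0)" by (intro tendsto_intros)
    then have "\<forall>\<^sub>F t in at_right 0. x v0 + t *\<^sub>R y \<in> U"
      using topological_tendstoD[OF _ oU] x0U by simp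
    then have "\<forall>\<^sub>F t in at_right 0. x v0 + t *\<^sub>R y \<in> U \<and> t > 0"
      using eventually_at_right_less[of "0::real"] by (rule eventually_conj)
    then obtain t where t: "x v0 + t *\<^sub>R y \<in> U" "t > 0"
      using eventually_happens'[of "at_right (0::real)"] by auto
    have "x v0 + t *\<^sub>R y \<in> ?I"
      using x0 cy(2) by (intro subspace_add subspace_scale subspace_InSpc)
    then have 1: "h (0, x v0 + t *\<^sub>R y) \<in> ?H" by (rule in_H[OF _ t(1)])
    have 2: "h (0, x v0) \<in> ?H" by (rule in_H[OF x0 x0U])
    have 3: "h (c, 0) \<in> ?T" unfolding T_eq by blast
    have "h (0, x v0 + t *\<^sub>R y) = h (0, x v0) + fscale t (h (0, y))"
      unfolding h_scale[symmetric] h_add[symmetric] by simp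
    then have "fscale t (h (0, y)) \<in> fs.span (?H \<union> ?T)"
      using fs.span_diff[OF fs.span_base[OF UnI1[OF 1]] fs.span_base[OF UnI1[OF 2]], of ?T] by simp
    then have "fscale (1 / t) (fscale t (h (0, y))) \<in> fs.span (?H \<union> ?T)" by (rule fs.span_scale)
    then have "h (0, y) \<in> fs.span (?H \<union> ?T)" using t(2) by simp
    then have "h (c, 0) + h (0, y) \<in> fs.span (?H \<union> ?T)"
      using 3 by (intro fs.span_add[OF fs.span_base]) auto
    then show "f \<in> fs.span (?H \<union> ?T)" unfolding h_add[symmetric] cy(1) by simp
  qed
  have "fdim (?H \<union> ?T) = fdim (h ` S)"
    using H_sub T_sub S_sub by (intro fdim_eqI) auto
  also have "\<dots> = dim S" by (rule fdim_linear_image[OF h_add h_scale S inj])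
  also have "\<dots> = DIM('a) + dim ?I"
    unfolding S_def by (simp add: dim_Times subspace_InSpc)
  finally have 1: "fdim (?H \<union> ?T) = DIM('a) + dim ?I" .
  have S': "subspace ((UNIV :: 'a set) \<times> {0 :: 'a})" by (intro subspace_Times subspace_UNIV) (rule subspace_single_0)
  have "fdim ?T = dim ((UNIV :: 'a set) \<times> {0 :: 'a})"
    unfolding T_eq
    by (rule fdim_linear_image[OF h_add h_scale S' inj]) (use \<open>0 \<in> ?I\<close> in \<open>auto simp: S_def\<close>)
  also have "\<dots> = DIM('a)" by (simp add: dim_Times)
  finally show ?thesis unfolding InCone_dim_def using 1 by simp
qed

section \<open>Signs of frames and even polygons\<close>

lemma reflect_orthogonal_transformation:
  assumes "orthogonal_transformation f"
  shows "f (reflect n x) = reflect (f n) (f x)"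
proof -
  have lin: "linear f" using assms orthogonal_transformation_linear by blast
  have "f a \<bullet> f b = a \<bullet> b" for a b using assms by (simp add: orthogonal_transformation_def)
  then show ?thesis by (simp add: reflect_def linear_diff[OF lin] linear_cmul[OF lin])
qed

text \<open>An orthogonal map that carries a coordinate direction to the direction of
  \<open>n\<close> conjugates the reflection to a diagonal one with a single entry -1.\<close>

lemma det_reflect:
  fixes n :: "real ^ 'n"
  assumes "n \<noteq> 0"
  shows "det (matrix (reflect n)) = - 1"
proof -
  obtain k :: 'n where True by blast
  let ?e = "axis k (1::real)"
  have nth: "axis i (1::real) $ j = (if j = i then 1 else 0)" for i j :: 'n
    by (simp add: axis_def)
  have "norm (norm n *\<^sub>R ?e) = norm n" by (simp add: norm_axis_1)
  then obtain f where f: "orthogonal_transformation f" "f (norm n *\<^sub>R ?e) = n"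
    using orthogonal_transformation_exists by blast
  have lf: "linear f" using f(1) orthogonal_transformation_linear by blast
  have lr: "linear (reflect m)" for m :: "real ^ 'n"
    using orthogonal_transformation_reflect orthogonal_transformation_linear by blast
  have re: "reflect (norm n *\<^sub>R ?e) = reflect ?e"
    using assms by (intro ext reflect_scaleR) simp
  have "reflect n \<circ> f = f \<circ> reflect ?e"
    using reflect_orthogonal_transformation[OF f(1), of "norm n *\<^sub>R ?e"] f(2) re by (auto simp: fun_eq_iff)
  then have "matrix (reflect n) ** matrix f = matrix f ** matrix (reflect ?e)"
    using matrix_compose[OF lf lr] matrix_compose[OF lr lf] by metis
  then have "det (matrix (reflect n)) * det (matrix f) = det (matrix f) * det (matrix (reflect ?e))"
    by (metis det_mul)
  moreover have "det (matrix f) \<noteq> 0" using orthogonal_transformation_det[OF f(1)] by auto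
  ultimately have "det (matrix (reflect n)) = det (matrix (reflect ?e))" by simp
  also have "\<dots> = (\<Prod>i\<in>UNIV. matrix (reflect ?e) $ i $ i)"
    by (rule det_diagonal) (auto simp: matrix_def reflect_def nth inner_axis_axis)
  also have "\<dots> = (\<Prod>i\<in>UNIV. if i = k then - 1 else 1)"
    by (intro prod.cong) (auto simp: matrix_def reflect_def nth inner_axis_axis)
  also have "\<dots> = - 1" by simp
  finally show ?thesis .
qed

text \<open>If the fixed space is not everything, it is a hyperplane, and its normal is sent to
  itself or to its negative. The first enlarges the fixed space; the second makes the map a
  reflection, of determinant -1.\<close>

lemma rotation_fixing_hyperplane:
  fixes f :: "real ^ 'n \<Rightarrow> real ^ 'n"
  assumes f: "orthogonal_transformation f" and det: "det (matrix f) = 1"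
    and S: "\<And>x. x \<in> S \<Longrightarrow> f x = x" "CARD('n) \<le> dim S + 1"
  shows "f x = x"
proof -
  have lin: "linear f" using f orthogonal_transformation_linear by blast
  have ip: "f a \<bullet> f b = a \<bullet> b" for a b using f by (simp add: orthogonal_transformation_def)
  define F where "F = {x. f x = x}"
  have F: "subspace F"
    unfolding subspace_def F_def by (auto simp: linear_0[OF lin] linear_add[OF lin] linear_cmul[OF lin])
  have "dim S \<le> dim F" by (rule dim_subset) (use S(1) in \<open>auto simp: F_def\<close>)
  then have dF: "CARD('n) \<le> dim F + 1" using S(2) by simp
  show ?thesis
  proof (rule ccontr)
    assume ne: "f x \<noteq> x"
    have "F \<noteq> UNIV" using ne unfolding F_def by blast
    then have "dim F < DIM(real ^ 'n)"
      using dim_eq_full[of F] dim_subset_UNIV[of F] span_eq_iff[of F] F by fastforce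
    then obtain m where m: "m \<noteq> 0" "\<And>y. y \<in> span F \<Longrightarrow> orthogonal m y"
      using orthogonal_to_subspace_exists[of F] by blast
    have mF: "m \<bullet> y = 0" if "y \<in> F" for y using m(2)[OF span_base[OF that]] by (simp add: orthogonal_def)
    have "F = {y. m \<bullet> y = 0}"
    proof (rule subspace_dim_equal[OF F subspace_hyperplane])
      show "F \<subseteq> {y. m \<bullet> y = 0}" using mF by blast
      show "dim {y. m \<bullet> y = 0} \<le> dim F" using dF m(1) by (simp add: dim_hyperplane)
    qed
    then have inF: "f y = y" if "m \<bullet> y = 0" for y using that unfolding F_def by blast
    have "f m \<bullet> y = 0" if "m \<bullet> y = 0" for y using ip[of m y] inF[OF that] that by simp
    then have fm: "f m = ((f m \<bullet> m) / (m \<bullet> m)) *\<^sub>R m" by (rule parallel_of_orthogonal_hyperplane)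
    define k where "k = (f m \<bullet> m) / (m \<bullet> m)"
    have fm': "f m = k *\<^sub>R m" using fm unfolding k_def .
    have "k * k * (m \<bullet> m) = m \<bullet> m" using ip[of m m] by (simp add: fm')
    then have "k * k = 1" using m(1) by simp
    then have "k = 1 \<or> k = - 1" by (simp add: square_eq_1_iff)
    moreover have "k \<noteq> 1"
    proof
      assume "k = 1"
      then have "m \<in> F" using fm' by (simp add: F_def)
      then show False using mF[of m] m(1) by simp
    qed
    ultimately have fm2: "f m = - m" using fm' by simp
    have "f y = reflect m y" for y
    proof -
      define t where "t = (y \<bullet> m) / (m \<bullet> m)"
      have "m \<bullet> (y - t *\<^sub>R m) = 0" using m(1) by (simp add: t_def inner_diff_right inner_commute)
      then have "f (y - t *\<^sub>R m) = y - t *\<^sub>R m" by (rule inF)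
      then have "f y = y - t *\<^sub>R m + t *\<^sub>R f m" by (simp add: linear_diff[OF lin] linear_cmul[OF lin] algebra_simps)
      also have "\<dots> = y - (2 * t) *\<^sub>R m" by (simp add: fm2 algebra_simps flip: scaleR_2)
      finally show ?thesis by (simp add: reflect_def t_def)
    qed
    then have "f = reflect m" by blast
    then show False using det det_reflect[OF m(1)] by simp
  qed
qed

text \<open>Both sums count the edges inside V, each edge once from its end of the given
  colour.\<close>

lemma bipartite_degree_sum:
  assumes "finite V" and sym: "\<And>v w. E v w \<longleftrightarrow> E w v"
    and col: "\<And>v w. v \<in> V \<Longrightarrow> w \<in> V \<Longrightarrow> E v w \<Longrightarrow> s v \<noteq> s w"
  shows "(\<Sum>v\<in>{v \<in> V. s v}. card {w \<in> V. E v w}) = (\<Sum>v\<in>{v \<in> V. \<not> s v}. card {w \<in> V. E v w})"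
proof -
  let ?A = "{v \<in> V. s v}" and ?B = "{v \<in> V. \<not> s v}"
  have "(\<Sum>v\<in>?A. card {w \<in> V. E v w}) = (\<Sum>v\<in>?A. card {w \<in> ?B. E v w})"
  proof (intro sum.cong refl)
    fix v assume "v \<in> ?A"
    then have "{w \<in> V. E v w} = {w \<in> ?B. E v w}" using col[of v] by blast
    then show "card {w \<in> V. E v w} = card {w \<in> ?B. E v w}" by simp
  qed
  also have "\<dots> = (\<Sum>w\<in>?B. card {v \<in> ?A. E v w})"
    by (rule sum_multicount_gen) (use \<open>finite V\<close> in auto)
  also have "\<dots> = (\<Sum>w\<in>?B. card {v \<in> V. E w v})"
  proof (intro sum.cong refl)
    fix w assume "w \<in> ?B"
    then have "{v \<in> ?A. E v w} = {v \<in> V. E w v}" using col[of w] sym by blast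
    then show "card {v \<in> ?A. E v w} = card {v \<in> V. E w v}" by simp
  qed
  finally show ?thesis .
qed

text \<open>Removing a vertex with neighbours a and b from an even cycle leaves a path with an odd number of
  vertices, whose ends get the same colour in any proper 2-colouring.\<close>

lemma cycle_minus_vertex_colours:
  fixes s :: "'a \<Rightarrow> bool"
  assumes fin: "finite V" and sym: "\<And>x y. E x y \<longleftrightarrow> E y x"
    and deg: "\<And>x. x \<in> V \<Longrightarrow> card {y \<in> V. E x y} = 2" and even: "even (card V)"
    and v: "v \<in> V" and ab: "a \<noteq> b" "{y \<in> V. E v y} = {a, b}" and irr: "\<not> E v v"
    and col: "\<And>x y. x \<in> V - {v} \<Longrightarrow> y \<in> V - {v} \<Longrightarrow> E x y \<Longrightarrow> s x \<noteq> s y"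
  shows "s a = s b"
proof (rule ccontr)
  assume ne: "s a \<noteq> s b"
  let ?V = "V - {v}"
  have abV: "a \<in> ?V" "b \<in> ?V" using ab irr by auto
  \<comment> \<open>Deleting v costs exactly \<open>a\<close> and \<open>b\<close> one neighbour
    each; the path is not followed, only degrees are counted.\<close>
  have d: "card {y \<in> ?V. E x y} + (if x = a \<or> x = b then 1 else 0) = 2" if x: "x \<in> ?V" for x
  proof (cases "E x v")
    case True
    then have "x = a \<or> x = b" using ab(2) x sym by blast
    moreover have "{y \<in> V. E x y} = insert v {y \<in> ?V. E x y}" using True v by blast
    then have "card {y \<in> V. E x y} = Suc (card {y \<in> ?V. E x y})" using fin by simp
    ultimately show ?thesis using deg[of x] x by simp
  next
    case False
    then have "\<not> (x = a \<or> x = b)" using ab(2) sym by blast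
    moreover have "{y \<in> V. E x y} = {y \<in> ?V. E x y}" using False by blast
    ultimately show ?thesis using deg[of x] x by simp
  qed
  have "(\<Sum>x\<in>A. card {y \<in> ?V. E x y}) + card (A \<inter> {a, b}) = 2 * card A" if A: "A \<subseteq> ?V" for A
  proof -
    have finA: "finite A" using A fin finite_subset by blast
    have "(\<Sum>x\<in>A. if x = a \<or> x = b then 1 else 0) = card (A \<inter> {x. x = a \<or> x = b})"
      using finA by (simp add: sum.If_cases)
    also have "{x. x = a \<or> x = b} = {a, b}" by blast
    finally have "card (A \<inter> {a, b}) = (\<Sum>x\<in>A. if x = a \<or> x = b then 1 else 0)" ..
    then have "(\<Sum>x\<in>A. card {y \<in> ?V. E x y}) + card (A \<inter> {a, b})
      = (\<Sum>x\<in>A. card {y \<in> ?V. E x y} + (if x = a \<or> x = b then 1 else 0))" by (simp add: sum.distrib)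
    also have "\<dots> = (\<Sum>x\<in>A. 2)" using A d by (intro sum.cong refl) blast
    finally show ?thesis by simp
  qed
  note count = this
  let ?A = "{x \<in> ?V. s x}" and ?B = "{x \<in> ?V. \<not> s x}"
  have "card (?A \<inter> {a, b}) = 1" "card (?B \<inter> {a, b}) = 1"
  proof -
    have "?A \<inter> {a, b} = (if s a then {a} else {b})" "?B \<inter> {a, b} = (if s a then {b} else {a})"
      using ne abV by auto
    then show "card (?A \<inter> {a, b}) = 1" "card (?B \<inter> {a, b}) = 1" by simp_all
  qed
  moreover have "(\<Sum>x\<in>?A. card {y \<in> ?V. E x y}) = (\<Sum>x\<in>?B. card {y \<in> ?V. E x y})"
    by (rule bipartite_degree_sum[OF finite_Diff[OF fin] sym col])
  moreover have "?A \<subseteq> ?V" "?B \<subseteq> ?V" by blast+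
  \<comment> \<open>Each colour class contains one of \<open>a\<close>, \<open>b\<close>, so its
    degree sum is twice its size minus 1. Equal sums make the classes equal in size, so deleting v
    would leave an even number of vertices.\<close>
  ultimately have AB: "card ?A = card ?B" using count[of ?A] count[of ?B] by linarith
  have "card ?V = card (?A \<union> ?B)" by (rule arg_cong[of _ _ card]) blast
  also have "\<dots> = card ?A + card ?B" using fin by (intro card_Un_disjoint) auto
  finally have "even (card ?V)" using AB by simp
  moreover have "card V = Suc (card ?V)" using fin v by (metis card_Suc_Diff1)
  ultimately show False using even by simp
qed

section \<open>Orthogonal frames along the edges and their determinants\<close>

lemma det_orthogonal_cases:
  fixes f :: "real ^ 'n \<Rightarrow> real ^ 'n"
  assumes "orthogonal_transformation f"
  shows "det (matrix f) = 1 \<or> det (matrix f) = - 1"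
  using orthogonal_transformation_det[OF assms] by (simp add: abs_eq_iff')

lemma det_reflect_compose:
  fixes f :: "real ^ 'n \<Rightarrow> real ^ 'n"
  assumes "orthogonal_transformation f" "n \<noteq> 0"
  shows "det (matrix (reflect n \<circ> f)) = - det (matrix f)"
  using matrix_compose[of f "reflect n"] assms det_reflect[OF assms(2)]
    orthogonal_transformation_linear orthogonal_transformation_reflect
  by (metis det_mul mult_minus1)

text \<open>\<open>A v p\<close> is the value at v of the family belonging to the parameter
  \<open>p\<close>. Only edges with both ends in \<open>S\<close> are constrained, so that frames
  can be built on part of the vertices.\<close>

definition edge_frames :: "'a::euclidean_space set \<Rightarrow> 'a set \<Rightarrow> ('a \<Rightarrow> 'a \<Rightarrow> 'a) \<Rightarrow> bool" where
  "edge_frames P S A \<longleftrightarrow> (\<forall>v. orthogonal_transformation (A v)) \<and>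
     (\<forall>v\<in>S. \<forall>w\<in>S. is_edge P v w \<longrightarrow> A w = reflect (w - v) \<circ> A v)"

lemma edge_framesD:
  assumes "edge_frames P S A"
  shows "orthogonal_transformation (A v)"
    and "v \<in> S \<Longrightarrow> w \<in> S \<Longrightarrow> is_edge P v w \<Longrightarrow> A w = reflect (w - v) \<circ> A v"
  using assms by (auto simp: edge_frames_def)

lemma edge_frames_subset:
  "edge_frames P S A \<Longrightarrow> G face_of P \<Longrightarrow> S' \<subseteq> S \<Longrightarrow> edge_frames G S' A"
  unfolding edge_frames_def using is_edge_of_face by blast

lemma det_edge_frames:
  fixes A :: "real ^ 'n \<Rightarrow> real ^ 'n \<Rightarrow> real ^ 'n"
  assumes "edge_frames P S A" "v \<in> S" "w \<in> S" "is_edge P v w"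
  shows "det (matrix (A v)) = 1 \<longleftrightarrow> det (matrix (A w)) \<noteq> 1"
proof -
  have "w - v \<noteq> 0" using assms(4) by (auto simp: is_edge_def)
  then have "det (matrix (A w)) = - det (matrix (A v))"
    unfolding edge_framesD(2)[OF assms] by (rule det_reflect_compose[OF edge_framesD(1)[OF assms(1)]])
  then show ?thesis using det_orthogonal_cases[OF edge_framesD(1)[OF assms(1), of v]] by auto
qed

text \<open>If every vector is a base value, the path maps from \<open>v0\<close> are frames.
  Conversely frames solve the family equations for all parameters at once, and surjectivity of
  \<open>A v0\<close> realizes every base value.\<close>

lemma InSpc_eq_UNIV_iff_edge_frames:
  fixes P :: "'a::euclidean_space set"
  assumes P: "polytope P" and v0: "v0 \<in> vertices P"
  shows "InSpc (normal_fan P) (normal_cone P {v0}) = UNIV \<longleftrightarrow> (\<exists>A. edge_frames P (vertices P) A)"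
proof
  assume U: "InSpc (normal_fan P) (normal_cone P {v0}) = UNIV"
  have "path_map P v0 w = reflect (w - v) \<circ> path_map P v0 v" if "is_edge P v w" for v w
    using edge_familyD[OF edge_family_path_map[OF P v0] that] U by (simp add: fun_eq_iff)
  then have "edge_frames P (vertices P) (path_map P v0)"
    by (simp add: edge_frames_def orthogonal_transformation_path_map)
  then show "\<exists>A. edge_frames P (vertices P) A" by blast
next
  assume "\<exists>A. edge_frames P (vertices P) A"
  then obtain A where A: "edge_frames P (vertices P) A" by blast
  have "y \<in> InSpc (normal_fan P) (normal_cone P {v0})" for y
  proof -
    obtain p where p: "A v0 p = y"
      using orthogonal_transformation_surj[OF edge_framesD(1)[OF A]] by (metis surjD)
    have "A w p = reflect (w - v) (A v p)" if "is_edge P v w" for v w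
      using edge_framesD(2)[OF A is_edge_vertices[OF that] that] by simp
    then have "edge_family P (\<lambda>v. A v p)" by (simp add: edge_family_def)
    then show ?thesis using edge_family_in_InSpc[OF P _ v0] p by blast
  qed
  then show "InSpc (normal_fan P) (normal_cone P {v0}) = UNIV" by blast
qed

text \<open>All degrees in a 2-face are 2, so equal degree sums over the two determinant classes
  give classes of equal size.\<close>

lemma even_polytope_of_edge_frames:
  fixes P :: "(real ^ 'n) set"
  assumes P: "polytope P" and A: "edge_frames P (vertices P) A"
  shows "even_polytope P"
  unfolding even_polytope_def
proof (intro allI impI)
  fix G assume G: "G face_of P \<and> aff_dim G = 2"
  have pG: "polytope G" using face_of_polytope_polytope[OF P] G by blast
  let ?V = "vertices G"
  let ?s = "\<lambda>v. det (matrix (A v)) = 1"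
  have fin: "finite ?V" by (rule finite_vertices[OF pG])
  have AG: "edge_frames G ?V A"
    using edge_frames_subset[OF A] G vertices_of_face[of G P] by blast
  have deg: "card {w \<in> ?V. is_edge G v w} = 2" if "v \<in> ?V" for v
  proof -
    have "{w \<in> ?V. is_edge G v w} = {w. is_edge G v w}" using is_edge_vertices(2) by blast
    then show ?thesis using polygon_vertex_degree[OF pG _ that] G by simp
  qed
  have "(\<Sum>v\<in>{v \<in> ?V. ?s v}. card {w \<in> ?V. is_edge G v w})
      = (\<Sum>v\<in>{v \<in> ?V. \<not> ?s v}. card {w \<in> ?V. is_edge G v w})"
    by (rule bipartite_degree_sum[OF fin is_edge_sym]) (use det_edge_frames[OF AG] in blast)
  moreover have "(\<Sum>v\<in>{v \<in> ?V. R v}. card {w \<in> ?V. is_edge G v w}) = (\<Sum>v\<in>{v \<in> ?V. R v}. 2)" for R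
    using deg by (intro sum.cong) auto
  ultimately have eq: "card {v \<in> ?V. ?s v} = card {v \<in> ?V. \<not> ?s v}" by simp
  have "card ?V = card ({v \<in> ?V. ?s v} \<union> {v \<in> ?V. \<not> ?s v})" by (rule arg_cong[of _ _ card]) blast
  also have "\<dots> = card {v \<in> ?V. ?s v} + card {v \<in> ?V. \<not> ?s v}"
    using fin by (intro card_Un_disjoint) auto
  finally show "even (card ?V)" using eq by simp
qed

text \<open>The parameter \<open>p\<close> is matched at the lowest vertex \<open>m\<close>.
  Decreasing edge paths reach \<open>m\<close> from every other vertex without passing through the
  top vertex v, whose edges carry no frame condition.\<close>

lemma polygon_frames_fix_family:
  fixes G :: "'a::euclidean_space set"
  assumes G: "polytope G" and inj: "inj_on (\<lambda>x. u \<bullet> x) (vertices G)"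
    and v: "v \<in> vertices G" "\<And>x. x \<in> vertices G \<Longrightarrow> u \<bullet> x \<le> u \<bullet> v"
    and A: "edge_frames G (vertices G - {v}) A" and z: "edge_family G z"
  shows "\<exists>p. \<forall>x\<in>vertices G - {v}. A x p = z x"
proof -
  have fin: "finite (vertices G)" using finite_vertices[OF G] .
  define m where "m = arg_min_on (\<lambda>x. u \<bullet> x) (vertices G)"
  have m: "m \<in> vertices G" and min: "\<And>x. x \<in> vertices G \<Longrightarrow> u \<bullet> m \<le> u \<bullet> x"
    using arg_min_if_finite[OF fin, of "\<lambda>x. u \<bullet> x"] v(1) unfolding m_def by (auto simp: not_less)
  have less: "u \<bullet> x < u \<bullet> y" if "x \<in> vertices G" "y \<in> vertices G" "u \<bullet> x \<le> u \<bullet> y" "x \<noteq> y" for x y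
    using inj_onD[OF inj, of x y] that by fastforce
  have c: "- u \<in> strict_cone G m" using less[OF m] min by (auto simp: strict_cone_def)
  obtain p where p: "A m p = z m"
    using orthogonal_transformation_surj[OF edge_framesD(1)[OF A]] by (metis surjD)
  have "w \<noteq> v \<longrightarrow> A w p = z w" if w: "w \<in> vertices G" for w
  proof (rule improving_path_induct[OF G m c w, where Q = "\<lambda>w. w \<noteq> v \<longrightarrow> A w p = z w"])
    show "m \<noteq> v \<longrightarrow> A m p = z m" using p by simp
    fix a b assume e: "is_edge G a b" and lt: "- u \<bullet> a < - u \<bullet> b" and IH: "b \<noteq> v \<longrightarrow> A b p = z b"
    show "a \<noteq> v \<longrightarrow> A a p = z a"
    proof
      assume "a \<noteq> v"
      have ab: "a \<in> vertices G" "b \<in> vertices G" using is_edge_vertices[OF e] by auto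
      have "b \<noteq> v" using lt v(2)[OF ab(1)] by auto
      then have "reflect (b - a) (A a p) = reflect (b - a) (z a)"
        using IH edge_framesD(2)[OF A _ _ e] edge_familyD[OF z e] ab \<open>a \<noteq> v\<close> by simp
      then show "A a p = z a" by (metis reflect_reflect)
    qed
  qed
  then show ?thesis by blast
qed

text \<open>Going around an even 2-face composes an even number of reflections, hence a rotation. It fixes the
  orthogonal complement of the 2-face pointwise, and also the point of the inscribed family at the base vertex,
  which lies outside that complement; together these span a hyperplane.\<close>

lemma even_polygon_frames_close_up:
  fixes G :: "(real ^ 'n) set"
  assumes G: "polytope G" "aff_dim G = 2" "even (card (vertices G))"
    and inj: "inj_on (\<lambda>x. u \<bullet> x) (vertices G)"
    and v: "v \<in> vertices G" "\<And>x. x \<in> vertices G \<Longrightarrow> u \<bullet> x \<le> u \<bullet> v"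
    and A: "edge_frames G (vertices G - {v}) A"
    and y: "edge_family G y" and a: "is_edge G v a" "y v \<bullet> (a - v) \<noteq> 0" and b: "is_edge G v b" "a \<noteq> b"
  shows "reflect (v - a) \<circ> A a = reflect (v - b) \<circ> A b"
proof -
  have fin: "finite (vertices G)" using finite_vertices[OF G(1)] .
  have oA: "orthogonal_transformation (A x)" for x using edge_framesD(1)[OF A] .
  have nbrs: "{w \<in> vertices G. is_edge G x w} = {w. is_edge G x w}" for x using is_edge_vertices(2) by blast
  have "finite {w. is_edge G v w}" unfolding nbrs[symmetric] using fin by simp
  moreover have "card {w. is_edge G v w} \<le> card {a, b}"
    using polygon_vertex_degree[OF G(1,2) v(1)] b(2) by simp
  ultimately have nb: "{w. is_edge G v w} = {a, b}"
    using card_seteq[of "{w. is_edge G v w}" "{a, b}"] a(1) b(1) by simp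
  have va: "v \<noteq> a" "v \<noteq> b" using a b by (auto simp: is_edge_def)
  have "(det (matrix (A a)) = 1) = (det (matrix (A b)) = 1)"
  proof (rule cycle_minus_vertex_colours[OF fin is_edge_sym _ G(3) v(1) b(2), where s = "\<lambda>x. det (matrix (A x)) = 1"])
    show "card {w \<in> vertices G. is_edge G x w} = 2" if "x \<in> vertices G" for x
      using polygon_vertex_degree[OF G(1,2) that] nbrs by simp
    show "{w \<in> vertices G. is_edge G v w} = {a, b}" using nb nbrs by simp
    show "\<not> is_edge G v v" by (simp add: is_edge_def)
  qed (use det_edge_frames[OF A] in blast)
  then have det: "det (matrix (A a)) = det (matrix (A b))"
    using det_orthogonal_cases[OF oA[of a]] det_orthogonal_cases[OF oA[of b]] by auto
  define B where "B = reflect (v - a) \<circ> A a"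
  define C where "C = reflect (v - b) \<circ> A b"
  have oB: "orthogonal_transformation B" and oC: "orthogonal_transformation C"
    unfolding B_def C_def by (intro orthogonal_transformation_compose orthogonal_transformation_reflect oA)+
  have detBC: "det (matrix B) = det (matrix C)"
    using det det_reflect_compose[OF oA] va by (simp add: B_def C_def)
  \<comment> \<open>\<open>B\<close> and \<open>C\<close> are the two candidate frames at v;
    \<open>f\<close> is the holonomy around G that compares them.\<close>
  define f where "f = C \<circ> inv B"
  have oiB: "orthogonal_transformation (inv B)" using orthogonal_transformation_inv[OF oB] .
  have of: "orthogonal_transformation f"
    unfolding f_def by (rule orthogonal_transformation_compose[OF oC oiB])
  have invB: "inv B (B p) = p" for p using orthogonal_transformation_inj[OF oB] by (rule inv_f_f)
  have fB: "f \<circ> B = C" by (auto simp: f_def invB fun_eq_iff)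
  have "det (matrix f) * det (matrix B) = det (matrix C)"
    using matrix_compose[of B f] orthogonal_transformation_linear[OF oB] orthogonal_transformation_linear[OF of] fB
    by (metis det_mul)
  then have detf: "det (matrix f) = 1"
    using detBC det_orthogonal_cases[OF oB] by auto
  \<comment> \<open>A family already closes up at v, so both candidates send the matched parameter
    to \<open>z v\<close>. This serves for \<open>y\<close> and for the constant families with value
    orthogonal to the directions of G.\<close>
  have fix_z: "f (z v) = z v" if z: "edge_family G z" for z
  proof -
    obtain p where p: "\<And>x. x \<in> vertices G - {v} \<Longrightarrow> A x p = z x"
      using polygon_frames_fix_family[OF G(1) inj v A z] by blast
    have "z v = B p" "z v = C p"
      using p[of a] p[of b] va is_edge_vertices(2)[OF a(1)] is_edge_vertices(2)[OF b(1)]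
        edge_familyD[OF z, of a v] edge_familyD[OF z, of b v] a(1) b(1)
      by (auto simp: B_def C_def is_edge_sym)
    then show ?thesis using fB by (metis comp_apply)
  qed
  define D where "D = span ((\<lambda>x. x - v) ` G)"
  have vG: "v \<in> G" using v(1) vertices_subset by blast
  have D: "subspace D" "dim D = 2"
    using G(2) aff_dim_eq_dim_subtract[of v G] hull_inc[OF vG, of affine] by (auto simp: D_def dim_span)
  have inD: "x - v \<in> D" if "x \<in> vertices G" for x
    unfolding D_def using that vertices_subset by (intro span_base) blast
  define L where "L = {l \<in> UNIV. \<forall>d\<in>D. orthogonal d l}"
  have "dim L + 2 = CARD('n)"
    using dim_subspace_orthogonal_to_vectors[of D "UNIV :: (real ^ 'n) set"] D by (simp add: L_def)
  moreover have "subspace L" unfolding L_def using subspace_orthogonal_to_vectors by simp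
  moreover have "y v \<notin> L"
  proof
    assume "y v \<in> L"
    then have "(a - v) \<bullet> y v = 0"
      using inD[OF is_edge_vertices(2)[OF a(1)]] unfolding L_def orthogonal_def by blast
    then show False using a(2) by (simp add: inner_commute)
  qed
  ultimately have dim: "CARD('n) \<le> dim (insert (y v) L) + 1"
    by (simp add: dim_insert span_eq_iff[THEN iffD2])
  have "f x = x" for x
  proof (rule rotation_fixing_hyperplane[OF of detf _ dim])
    fix x assume "x \<in> insert (y v) L"
    then consider "x = y v" | "x \<in> L" by blast
    then show "f x = x"
    proof cases
      case 1 then show ?thesis using fix_z[OF y] by simp
    next
      case 2
      have "reflect (w - w') x = x" if "is_edge G w' w" for w w'
      proof (rule reflect_orthogonal)
        have "(w - v) - (w' - v) \<in> D"
          using subspace_diff[OF D(1) inD inD] is_edge_vertices[OF that] by blast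
        then have "w - w' \<in> D" by simp
        then have "(w - w') \<bullet> x = 0" using 2 unfolding L_def orthogonal_def by blast
        then show "x \<bullet> (w - w') = 0" by (simp add: inner_commute)
      qed
      then have "edge_family G (\<lambda>_. x)" by (simp add: edge_family_def)
      then show ?thesis by (rule fix_z)
    qed
  qed
  then have "B = C" using fB by (auto simp: fun_eq_iff)
  then show ?thesis unfolding B_def C_def .
qed

section \<open>Frames on even polytopes\<close>

text \<open>The slopes f a below order the lower edges at v: they are the heights of the vertices of the vertex
  figure at v, and lower edges whose slope is not minimal share a 2-face with a lower edge of smaller slope.\<close>

lemma lower_edges_frames_agree:
  fixes P :: "(real ^ 'n) set"
  assumes P: "polytope P" "even_polytope P"
    and inj: "inj_on (\<lambda>x. u \<bullet> x) (vertices P)" and v: "v \<in> vertices P"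
    and A: "edge_frames P {x \<in> vertices P. u \<bullet> x < u \<bullet> v} A"
    and y: "edge_family P y" and neg: "\<And>v w. is_edge P v w \<Longrightarrow> y v \<bullet> (w - v) < 0"
    and a: "is_edge P v a" "u \<bullet> a < u \<bullet> v" and b: "is_edge P v b" "u \<bullet> b < u \<bullet> v"
  shows "reflect (v - a) \<circ> A a = reflect (v - b) \<circ> A b"
proof -
  define N where "N = {a. is_edge P v a \<and> u \<bullet> a < u \<bullet> v}"
  have NV: "N \<subseteq> vertices P" unfolding N_def using is_edge_vertices(2) by blast
  have finN: "finite N" using NV finite_vertices[OF P(1)] finite_subset by blast
  have aN: "a \<in> N" and bN: "b \<in> N" using a b by (auto simp: N_def)
  \<comment> \<open>For lower edges, \<open>c \<bullet> d a b = 0\<close> says that \<open>a\<close>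
    and \<open>b\<close> have equal slope \<open>f\<close>. Distinct edges at v are not parallel, so
    \<open>d a b\<close> is nonzero and a generic \<open>c\<close> separates all slopes.\<close>
  define d where "d a b = (u \<bullet> (a - v)) *\<^sub>R (b - v) - (u \<bullet> (b - v)) *\<^sub>R (a - v)" for a b
  have neg_u: "u \<bullet> (a - v) < 0" if "a \<in> N" for a using that by (simp add: N_def inner_diff_right)
  have d0: "d a b \<noteq> 0" if ab: "a \<in> N" "b \<in> N" "a \<noteq> b" for a b
  proof
    assume d: "d a b = 0"
    have e: "is_edge P v a" "is_edge P v b" using ab by (auto simp: N_def)
    obtain c where c: "c \<bullet> a = c \<bullet> v" "\<forall>x\<in>vertices P. x \<noteq> a \<longrightarrow> x \<noteq> v \<longrightarrow> c \<bullet> x < c \<bullet> v"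
      using edge_exposing_functional[OF P(1) e(1)] by blast
    have "b \<noteq> v" using e(2) by (auto simp: is_edge_def)
    then have "c \<bullet> (b - v) < 0" using c(2) ab(3) is_edge_vertices(2)[OF e(2)] by (simp add: inner_diff_right)
    moreover have "c \<bullet> (a - v) = 0" using c(1) by (simp add: inner_diff_right)
    moreover have "(u \<bullet> (a - v)) * (c \<bullet> (b - v)) = (u \<bullet> (b - v)) * (c \<bullet> (a - v))"
      using arg_cong[OF d, of "inner c"] by (simp add: d_def inner_diff_right[of c "_ *\<^sub>R _"])
    ultimately show False using neg_u[OF ab(1)] by simp
  qed
  have "\<exists>c\<in>strict_cone P v. \<forall>z\<in>(\<lambda>(a, b). d a b) ` {(a, b) \<in> N \<times> N. a \<noteq> b}. c \<bullet> z \<noteq> 0"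
  proof (rule generic_functional)
    have "finite {(a, b) \<in> N \<times> N. a \<noteq> b}" by (rule finite_subset[of _ "N \<times> N"]) (use finN in auto)
    then show "finite ((\<lambda>(a, b). d a b) ` {(a, b) \<in> N \<times> N. a \<noteq> b})" by (rule finite_imageI)
    show "0 \<notin> (\<lambda>(a, b). d a b) ` {(a, b) \<in> N \<times> N. a \<noteq> b}" using d0 by (auto simp: eq_commute[of 0])
  qed (use open_strict_cone[OF P(1)] strict_cone_nonempty[OF P(1) v] in auto)
  then obtain c where c: "c \<in> strict_cone P v" and
      cd: "\<And>a b. a \<in> N \<Longrightarrow> b \<in> N \<Longrightarrow> a \<noteq> b \<Longrightarrow> c \<bullet> d a b \<noteq> 0" by auto
  have neg_c: "c \<bullet> (a - v) < 0" if "is_edge P v a" for a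
    using c is_edge_vertices(2)[OF that] that by (auto simp: strict_cone_def inner_diff_right is_edge_def)
  define f where "f a = (u \<bullet> (a - v)) / - (c \<bullet> (a - v))" for a
  have uf: "u \<bullet> (a - v) = f a * - (c \<bullet> (a - v))" if "is_edge P v a" for a
    using neg_c[OF that] by (simp add: f_def)
  have f_inj: "f a \<noteq> f b" if ab: "a \<in> N" "b \<in> N" "a \<noteq> b" for a b
  proof
    assume eq: "f a = f b"
    have "c \<bullet> d a b = (u \<bullet> (a - v)) * (c \<bullet> (b - v)) - (u \<bullet> (b - v)) * (c \<bullet> (a - v))"
      by (simp add: d_def inner_diff_right[of c "_ *\<^sub>R _"])
    also have "\<dots> = 0" using uf[of a] uf[of b] ab eq by (simp add: N_def)
    finally show False using cd[OF ab] by simp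
  qed
  define m where "m = arg_min_on f N"
  have m: "m \<in> N" and min: "\<And>a. a \<in> N \<Longrightarrow> f m \<le> f a"
    using arg_min_if_finite[OF finN, of f] aN unfolding m_def by (auto simp: not_less)
  have "reflect (v - a) \<circ> A a = reflect (v - m) \<circ> A m" if "a \<in> N" for a
    using finN that
  proof (induction rule: finite_ascent_induct[where f = "\<lambda>a. - f a"])
    case (step a)
    show ?case
    proof (cases "a = m")
      case False
      have ea: "is_edge P v a" and em: "is_edge P v m" using step.hyps m by (auto simp: N_def)
      have fma: "f m < f a" using min[OF step.hyps] f_inj[OF m step.hyps] False by fastforce
      \<comment> \<open>\<open>p\<close> vanishes along the edge to \<open>a\<close> and is positive
        on exactly the edges of smaller slope, such as the one to \<open>m\<close>. A 2-face through
        the edge to \<open>a\<close> on which \<open>p\<close> improves thus has its second edge of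
        smaller slope.\<close>
      define p where "p = - (u + f a *\<^sub>R c)"
      have p: "p \<bullet> (x - v) = (f a - f x) * - (c \<bullet> (x - v))" if "is_edge P v x" for x
        using uf[OF that] by (simp add: p_def inner_left_distrib algebra_simps)
      have "p \<bullet> (a - v) = 0" using p[OF ea] by simp
      then have pa: "p \<bullet> a = p \<bullet> v" by (simp add: inner_diff_right)
      have "p \<bullet> (m - v) > 0" unfolding p[OF em] using fma neg_c[OF em] by (intro mult_pos_pos) auto
      then have pm: "p \<bullet> v < p \<bullet> m" by (simp add: inner_diff_right)
      have mP: "m \<in> P" using m NV vertices_subset by blast
      obtain G b where G: "G face_of P" "aff_dim G = 2" "is_edge G v a" "is_edge G v b" "p \<bullet> v < p \<bullet> b"
        using improving_two_face[OF P(1) ea pa mP pm] by blast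
      have pG: "polytope G" using face_of_polytope_polytope[OF P(1) G(1)] .
      have eb: "is_edge P v b" using G(4) is_edge_of_face[OF G(1)] by blast
      have "p \<bullet> (b - v) > 0" using G(5) by (simp add: inner_diff_right)
      then have fb: "f b < f a" using neg_c[OF eb] unfolding p[OF eb] by (auto simp: mult_less_0_iff)
      have ab: "a \<noteq> b" using fb by auto
      \<comment> \<open>Lower edges have negative slope, and a slope below \<open>f a\<close> is
        negative too, so \<open>b\<close> is again a lower neighbour.\<close>
      have "f a < 0" using neg_u[OF step.hyps] neg_c[OF ea] by (simp add: f_def divide_neg_neg)
      then have "f b < 0" using fb by simp
      then have "u \<bullet> (b - v) < 0" unfolding uf[OF eb] using neg_c[OF eb] by (intro mult_neg_pos) auto
      then have bN: "b \<in> N" using eb by (simp add: N_def inner_diff_right)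
      have VG: "vertices G = vertices P \<inter> G" by (rule vertices_of_face[OF G(1)])
      have vG: "v \<in> vertices G" using is_edge_vertices(1)[OF G(3)] .
      have injG: "inj_on (\<lambda>x. u \<bullet> x) (vertices G)" using inj VG inj_on_subset by blast
      have finG: "finite {w. is_edge G v w}"
        by (rule finite_subset[OF _ finite_vertices[OF pG]]) (use is_edge_vertices(2) in blast)
      moreover have "card {w. is_edge G v w} \<le> card {a, b}"
        using polygon_vertex_degree[OF pG G(2) vG] ab by simp
      ultimately have nb: "{w. is_edge G v w} = {a, b}"
        using card_seteq[of "{w. is_edge G v w}" "{a, b}"] G(3,4) by simp
      \<comment> \<open>Both edges of G at v go down, so v is the top vertex of G and every other
        vertex of G already carries a frame.\<close>
      have top: "u \<bullet> x \<le> u \<bullet> v" if x: "x \<in> vertices G" for x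
      proof (rule ccontr)
        assume "\<not> ?thesis"
        then have "u \<bullet> v < u \<bullet> x" by simp
        moreover have "x \<in> G" using x vertices_subset by blast
        ultimately obtain w where w: "is_edge G v w" "u \<bullet> v < u \<bullet> w"
          using improving_edge[OF pG vG] by blast
        then have "w = a \<or> w = b" using nb by blast
        then show False using w(2) step.hyps bN by (auto simp: N_def)
      qed
      have AG: "edge_frames G (vertices G - {v}) A"
      proof (rule edge_frames_subset[OF A G(1)])
        show "vertices G - {v} \<subseteq> {x \<in> vertices P. u \<bullet> x < u \<bullet> v}"
          using top inj_onD[OF injG, of _ v] vG VG by (force simp: order.strict_iff_order)
      qed
      have yG: "edge_family G y" using y is_edge_of_face[OF G(1)] by (simp add: edge_family_def)
      have "reflect (v - a) \<circ> A a = reflect (v - b) \<circ> A b"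
      proof (rule even_polygon_frames_close_up[OF pG G(2) _ injG vG top AG yG G(3) _ G(4) ab])
        show "even (card (vertices G))" using P(2) G(1,2) by (simp add: even_polytope_def)
        show "y v \<bullet> (a - v) \<noteq> 0" using neg[OF ea] by simp
      qed
      then show ?thesis using step.IH[OF bN] fb by simp
    qed simp
  qed
  then show ?thesis using aN bN by simp
qed

lemma edge_frames_of_even_polytope:
  fixes P :: "(real ^ 'n) set"
  assumes P: "polytope P" "even_polytope P"
    and y: "edge_family P y" and neg: "\<And>v w. is_edge P v w \<Longrightarrow> y v \<bullet> (w - v) < 0"
  shows "\<exists>A. edge_frames P (vertices P) A"
proof -
  let ?V = "vertices P"
  have fin: "finite ?V" by (rule finite_vertices[OF P(1)])
  have "\<exists>u\<in>UNIV. \<forall>z\<in>(\<lambda>(v, w). v - w) ` {(v, w) \<in> ?V \<times> ?V. v \<noteq> w}. u \<bullet> z \<noteq> 0"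
  proof (rule generic_functional)
    have "finite {(v, w) \<in> ?V \<times> ?V. v \<noteq> w}" by (rule finite_subset[of _ "?V \<times> ?V"]) (use fin in auto)
    then show "finite ((\<lambda>(v, w). v - w) ` {(v, w) \<in> ?V \<times> ?V. v \<noteq> w})" by (rule finite_imageI)
  qed auto
  then obtain u where u: "\<And>v w. v \<in> ?V \<Longrightarrow> w \<in> ?V \<Longrightarrow> v \<noteq> w \<Longrightarrow> u \<bullet> (v - w) \<noteq> 0" by auto
  have inj: "inj_on (\<lambda>x. u \<bullet> x) ?V"
  proof (rule inj_onI)
    fix v w assume "v \<in> ?V" "w \<in> ?V" "u \<bullet> v = u \<bullet> w"
    then show "v = w" using u[of v w] by (auto simp: inner_diff_right)
  qed
  \<comment> \<open>Induction over down-closed vertex sets: a vertex is added only when all vertices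
    below it carry frames.\<close>
  have "\<forall>v\<in>S. \<forall>w\<in>?V. u \<bullet> w < u \<bullet> v \<longrightarrow> w \<in> S \<Longrightarrow> S \<subseteq> ?V \<Longrightarrow> \<exists>A. edge_frames P S A"
    if "finite S" for S
    using that
  proof (induction S rule: finite_ranking_induct[where f = "\<lambda>x. u \<bullet> x"])
    case empty
    have "edge_frames P {} (\<lambda>_. id)" by (simp add: edge_frames_def orthogonal_transformation_id id_def)
    then show ?case by blast
  next
    case (insert v S)
    show ?case
    \<comment> \<open>The induction rule adds an element of maximal value that may already be
      present.\<close>
    proof (cases "v \<in> S")
      case True
      then show ?thesis using insert by (simp add: insert_absorb)
    next
      case False
      have v: "v \<in> ?V" and SV: "S \<subseteq> ?V" using insert.prems by auto
      have lt: "u \<bullet> x < u \<bullet> v" if "x \<in> S" for x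
        using insert.hyps(2)[OF that] inj_onD[OF inj, of x v] SV v that False by force
      have S: "S = {x \<in> ?V. u \<bullet> x < u \<bullet> v}" using lt SV insert.prems(1) by force
      have "\<forall>v\<in>S. \<forall>w\<in>?V. u \<bullet> w < u \<bullet> v \<longrightarrow> w \<in> S" unfolding S by force
      then obtain A where A: "edge_frames P S A" using insert.IH SV by blast
      note oA = edge_framesD(1)[OF A]
      obtain B where B: "orthogonal_transformation B"
          "\<And>x. x \<in> S \<Longrightarrow> is_edge P v x \<Longrightarrow> B = reflect (v - x) \<circ> A x"
      proof (cases "\<exists>a\<in>S. is_edge P v a")
        case True
        then obtain a where a: "a \<in> S" "is_edge P v a" by blast
        show ?thesis
        proof (rule that[of "reflect (v - a) \<circ> A a"])
          show "orthogonal_transformation (reflect (v - a) \<circ> A a)"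
            by (intro orthogonal_transformation_compose orthogonal_transformation_reflect oA)
          fix x assume "x \<in> S" "is_edge P v x"
          then show "reflect (v - a) \<circ> A a = reflect (v - x) \<circ> A x"
            using lower_edges_frames_agree[OF P inj v A[unfolded S] y neg a(2) lt[OF a(1)]] lt by blast
        qed
      next
        \<comment> \<open>No lower neighbour constrains the frame at v, so any orthogonal map will
          do.\<close>
        case False
        then show ?thesis using that[of id] by (auto simp: orthogonal_transformation_id id_def)
      qed
      have "edge_frames P (insert v S) (A(v := B))"
        unfolding edge_frames_def
      proof (intro conjI allI ballI impI)
        show "orthogonal_transformation ((A(v := B)) x)" for x using B(1) oA by simp
        fix x w assume xw: "x \<in> insert v S" "w \<in> insert v S" and e: "is_edge P x w"
        have "x \<noteq> w" using e by (simp add: is_edge_def)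
        then consider "x \<in> S" "w \<in> S" | "x \<in> S" "w = v" | "x = v" "w \<in> S" using xw by blast
        then show "(A(v := B)) w = reflect (w - x) \<circ> (A(v := B)) x"
        proof cases
          case 1
          then show ?thesis using edge_framesD(2)[OF A 1 e] False by auto
        next
          case 2
          then show ?thesis using B(2)[of x] e False by (auto simp: is_edge_sym)
        next
          case 3
          have "reflect (w - v) \<circ> B = A w"
            using B(2)[OF 3(2)] e 3(1) reflect_minus_commute[of v w]
            by (simp add: fun_eq_iff reflect_reflect)
          then show ?thesis using 3 False by auto
        qed
      qed
      then show ?thesis by blast
    qed
  qed
  then show ?thesis using fin by blast
qed

theorem theorem4p14:
  fixes P :: "(real ^ 'd) set"
  assumes "polytope P"
    and "aff_dim P = int CARD('d)"
    and "\<exists>Q. inscribed Q \<and> normal_fan Q = normal_fan P"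
  shows "(even_polytope P \<longleftrightarrow> InCone_dim P = CARD('d))
       \<and> (InCone_dim P = CARD('d) \<longleftrightarrow>
            (\<forall>R0 \<in> regions (normal_fan P). InSpc (normal_fan P) R0 = UNIV))"
proof -
  have P0: "P \<noteq> {}" using assms(2) by auto
  have full: "aff_dim P = int DIM(real ^ 'd)" using assms(2) by simp
  obtain Q where Q: "Q \<in> inscribed_realizations P"
    using assms(3) by (auto simp: inscribed_realizations_def)
  then obtain y where y: "edge_family P y" "\<And>v w. is_edge P v w \<Longrightarrow> y v \<bullet> (w - v) < 0"
    using inscribed_realization_edge_family[OF assms(1) P0 Q] by blast
  obtain v0 where v0: "v0 \<in> vertices P" using vertices_nonempty[OF assms(1) P0] by blast
  \<comment> \<open>Stated for every vertex, since the normal cones of the vertices are all the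
    regions that (iii) ranges over.\<close>
  have ii: "InCone_dim P = CARD('d) \<longleftrightarrow> InSpc (normal_fan P) (normal_cone P {v}) = UNIV"
    if v: "v \<in> vertices P" for v
  proof -
    have "InCone_dim P = dim (InSpc (normal_fan P) (normal_cone P {v}))"
      using InCone_dim_eq_dim_InSpc[OF assms(1) full _ v] Q by blast
    moreover have "dim (InSpc (normal_fan P) (normal_cone P {v})) = CARD('d)
        \<longleftrightarrow> InSpc (normal_fan P) (normal_cone P {v}) = UNIV"
      using dim_eq_full[of "InSpc (normal_fan P) (normal_cone P {v})"]
      unfolding span_eq_iff[THEN iffD2, OF subspace_InSpc] by simp
    ultimately show ?thesis by simp
  qed
  have "even_polytope P \<longleftrightarrow> (\<exists>A. edge_frames P (vertices P) A)"
    using edge_frames_of_even_polytope[OF assms(1) _ y] even_polytope_of_edge_frames[OF assms(1)] by blast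
  then have "even_polytope P \<longleftrightarrow> InCone_dim P = CARD('d)"
    using InSpc_eq_UNIV_iff_edge_frames[OF assms(1) v0] ii[OF v0] by simp
  moreover have "InCone_dim P = CARD('d) \<longleftrightarrow>
      (\<forall>R0 \<in> regions (normal_fan P). InSpc (normal_fan P) R0 = UNIV)"
    using ii v0 unfolding regions_normal_fan[OF assms(1)] by blast
  ultimately show ?thesis by blast
qed

end
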